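(* Let $\mathcal R=\mathcal R(\mathbb F_2)$, $\mathcal N=\mathcal N(\mathbb F_2)$, and $\mathcal A$, $\mathcal A_m$ be as in the context. For all integers $n\ge2$, $$\gamma_n(\mathcal R)\cong\mathcal A_{2n-3}\ltimes\gamma_n(\mathcal N),$$ and the lower central quotients are $$\gamma_i(\mathcal R)/\gamma_{i+1}(\mathcal R)\cong\begin{cases}(\mathbb Z_2)^3\times\mathbb Z_4 & \text{if } i=1,\\ (\mathbb Z_2)^4 & \text{if } i\ge2 \text{ is even},\\ (\mathbb Z_2)^6 & \text{if } i>1 \text{ is odd}.\end{cases}$$ Moreover, letting $F_{\mathcal R}:\mathcal R\to\mathcal R^{ab}=\mathcal R/\gamma_2(\mathcal R)$ be the abelianization map, $a=F_{\mathcal R}((1+t,t))$ and $b_i=F_{\mathcal R}((1,t+t^{i+1}))$ for $i\ge1$, the abelian group $\mathcal R^{ab}$ has the presentation $$\langle a,\ b_1,\ b_1b_2,\ b_4\mid a^2=(b_1b_2)^2=b_4^2=b_1^4=1,\ [b_i,b_j]=1,\ [a,b_i]=1\rangle,$$ i.e. $\mathcal R^{ab}$ is the direct product of the cyclic subgroups generated by $a$ (order 2), $b_1$ (order 4), $b_1b_2$ (order 2) and $b_4$ (order 2).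
   Context: The Riordan group $\mathcal R=\mathcal R(\mathbb F_2)$ consists of pairs $(g,f)$ of formal power series over $\mathbb F_2$ with $g=1+g_1t+\cdots$, $f=t+f_2t^2+\cdots$, identified with lower triangular matrices $(d_{n,k})$, $d_{n,k}=[t^n]gf^k$; the product is $(g_1,f_1)(g_2,f_2)=(g_1\cdot(g_2\circ f_1),\,f_2\circ f_1)$, identity $(1,t)$. It is a pro-2 group, the inverse limit of its finite truncations (upper-left $(n+1)\times(n+1)$ corners), with the corresponding profinite ($t$-adic) topology. The Appell subgroup $\mathcal A=\{(g,t)\}$ is normal abelian; for $m\ge0$, $\mathcal A_m=\{(g,t): g\equiv1\pmod{t^{m+1}}\}$. The Nottingham group $\mathcal N=\mathcal N(\mathbb F_2)=\{(1,f)\}$ is a subgroup, and $\mathcal R=\mathcal A\rtimes\mathcal N$. The lower central series is $\gamma_1(G)=G$, $\gamma_{i}(G)=[\gamma_{i-1}(G),G]$, where for closed normal subgroups $X,Y$, $[X,Y]$ is the smallest closed subgroup containing all commutators $[x,y]=x^{-1}y^{-1}xy$, $x\in X$, $y\in Y$. $\mathbb Z_q=\mathbb Z/q\mathbb Z$. *)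

theory Defs
  imports "HOL-Library.Z2" "HOL-Computational_Algebra.Formal_Power_Series"
          "HOL-Algebra.Algebra"
begin

type_synonym rpair = "bit fps \<times> bit fps"

definition riordan_carrier :: "rpair set" where
  "riordan_carrier = {(g, f). fps_nth g 0 = 1 \<and> fps_nth f 0 = 0 \<and> fps_nth f 1 = 1}"

definition Riordan :: "rpair monoid" where
  "Riordan = \<lparr> carrier = riordan_carrier,
     mult = (\<lambda>(g1, f1) (g2, f2). (g1 * (g2 oo f1), f2 oo f1)),
     one = (1, fps_X) \<rparr>"

definition Appell :: "rpair set" where
  "Appell = {(g, f) \<in> riordan_carrier. f = fps_X}"

definition Appell_m :: "nat \<Rightarrow> rpair set" where
  "Appell_m m = {(g, f) \<in> Appell. \<forall>k. 1 \<le> k \<and> k \<le> m \<longrightarrow> fps_nth g k = 0}"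

definition Nottingham :: "rpair set" where
  "Nottingham = {(g, f) \<in> riordan_carrier. g = 1}"

text \<open>Closure in the profinite (t-adic) topology: x lies in the closure of S iff for every
  N some element of S agrees with x in all coefficients of index at most N (equivalently,
  has the same (N+1)x(N+1) truncation as a lower triangular matrix).\<close>
definition rclosure :: "rpair set \<Rightarrow> rpair set" where
  "rclosure S = {x \<in> riordan_carrier. \<forall>N. \<exists>h\<in>S. \<forall>k\<le>N.
       fps_nth (fst h) k = fps_nth (fst x) k \<and> fps_nth (snd h) k = fps_nth (snd x) k}"

definition rcomm :: "rpair \<Rightarrow> rpair \<Rightarrow> rpair" where
  "rcomm x y = mult Riordan (mult Riordan (mult Riordan (m_inv Riordan x) (m_inv Riordan y)) x) y"

definition closed_comm :: "rpair set \<Rightarrow> rpair set \<Rightarrow> rpair set" where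
  "closed_comm P Q = Inter {K. subgroup K Riordan \<and> rclosure K = K \<and>
                          {rcomm x y | x y. x \<in> P \<and> y \<in> Q} \<subseteq> K}"

text \<open>lcs_aux H k = gamma_(k+1)(H).\<close>
primrec lcs_aux :: "rpair set \<Rightarrow> nat \<Rightarrow> rpair set" where
  "lcs_aux H 0 = H"
| "lcs_aux H (Suc k) = closed_comm (lcs_aux H k) H"

definition gamma :: "rpair set \<Rightarrow> nat \<Rightarrow> rpair set" where
  "gamma H i = lcs_aux H (i - 1)"

definition Zmod :: "nat \<Rightarrow> int monoid" where
  "Zmod q = integer_mod_group q"

definition Rab :: "rpair set monoid" where
  "Rab = Riordan Mod (gamma riordan_carrier 2)"

definition F_R :: "rpair \<Rightarrow> rpair set" where
  "F_R x = gamma riordan_carrier 2 #>\<^bsub>Riordan\<^esub> x"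

end

theory Submission
  imports Defs
begin

text \<open>
  Write a series over \<open>\<bbbF>\<^sub>2\<close> as \<open>f = P\<^sup>2 + t S\<^sup>2\<close> with \<open>P\<close> its even and \<open>S\<close> its odd part. Since
  squaring is additive, \<open>S\<close> is multiplicative under substitution: the odd part of \<open>f \<circ> h\<close> is
  \<open>S\<^sub>h \<cdot> (S\<^sub>f \<circ> h)\<close>. So \<open>f \<mapsto> (S\<^sub>f, f)\<close> embeds the Nottingham group into the Riordan group, and the
  easy fact that \<open>\<gamma>\<^sub>n(\<R>)\<close> has first component congruent to 1 modulo \<open>t\<^bsup>2n-2\<^esup>\<close> already forces the
  coefficients of \<open>S\<^sub>f\<close> of index \<open>1, \<dots>, 2n - 3\<close> to vanish for \<open>f \<in> \<gamma>\<^sub>n(\<N>)\<close>. Computing two more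
  coefficients of the odd part of a commutator gives the remaining linear conditions on \<open>\<gamma>\<^sub>n(\<N>)\<close>:
  the coefficients of \<open>S\<^sub>f\<close> of index \<open>2n - 2\<close> (\<open>n\<close> even) and \<open>2n - 1\<close> are determined by the
  leading coefficient of \<open>P\<^sub>f\<close>.

  Conversely, a closed subgroup contains every element that can be moved arbitrarily close to the
  identity by multiplying it with elements of that subgroup. An element of \<open>\<gamma>\<^bsub>n+1\<^esub>(\<N>)\<close> is moved
  to the identity by commutators with \<open>t + t\<^sup>2\<close> and \<open>t + t\<^sup>3\<close>, which clear the coefficients of
  \<open>P\<close> and \<open>S\<close> in the order \<open>P\<^sub>m, S\<^bsub>m+n-1\<^esub>\<close> for \<open>m = n + 1, n + 2, \<dots>\<close>: the commutators that
  clear \<open>P\<^sub>m\<close> have trivial odd part below the index \<open>m + n - 1\<close>, whereas some of those that clear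
  \<open>S\<^sub>j\<close> have a nontrivial even part from the index \<open>j - n + 2\<close> on. The quotients are read off from
  the coefficients that are additive on \<open>\<gamma>\<^sub>n\<close> and whose common kernel is \<open>\<gamma>\<^bsub>n+1\<^esub>\<close>.
\<close>

unbundle fps_syntax

section \<open>Truncated power series over the field with two elements\<close>

text \<open>These simp rules of \<open>Z2\<close> turn sums and products of bits into bit operations, which blocks
  ring normalization.\<close>
declare add_bit_eq_xor [simp del] mult_bit_eq_and [simp del] power_bit_unfold [simp del]

lemma bit_add_self [simp]: "a + a = (0::bit)"
  by (cases a) simp_all

lemma bit_add_self_left [simp]: "a + (a + b) = (b::bit)"
  by (simp flip: add.assoc)

lemma bit_mult_self [simp]: "a * a = (a::bit)"
  by (cases a) simp_all

lemma bit_mult_self_left [simp]: "a * (a * b) = a * (b::bit)"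
  by (simp flip: mult.assoc)

lemma bit_add_eq_0_iff: "a + b = 0 \<longleftrightarrow> a = (b::bit)"
  by (cases a; cases b) simp_all

lemma bit_fps_add_self [simp]: "f + f = (0::bit fps)"
  by (rule fps_ext) (simp only: fps_add_nth bit_add_self fps_zero_nth)

lemma bit_fps_add_self_left [simp]: "f + (f + g) = (g::bit fps)"
  by (simp flip: add.assoc)

lemma bit_of_nat: "(of_nat n :: bit) = of_bool (odd n)"
  by (induction n) auto

lemma bit_fps_add_eq_iff: "f + g = h \<longleftrightarrow> f = g + (h :: bit fps)"
  by (metis add.commute bit_fps_add_self_left)

definition agree :: "nat \<Rightarrow> 'a fps \<Rightarrow> 'a fps \<Rightarrow> bool" where
  "agree m f g \<longleftrightarrow> (\<forall>k<m. f $ k = g $ k)"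

lemma agreeD: "agree m f g \<Longrightarrow> k < m \<Longrightarrow> f $ k = g $ k"
  by (simp add: agree_def)

lemma agree_refl [simp]: "agree m f f"
  by (simp add: agree_def)

lemma agree_sym: "agree m f g \<Longrightarrow> agree m g f"
  by (simp add: agree_def)

lemma agree_trans [trans]: "agree m f g \<Longrightarrow> agree m g h \<Longrightarrow> agree m f h"
  by (simp add: agree_def)

lemma agree_mono: "agree m f g \<Longrightarrow> k \<le> m \<Longrightarrow> agree k f g"
  by (simp add: agree_def)

lemma agree_Suc: "agree (Suc m) f g \<longleftrightarrow> agree m f g \<and> f $ m = g $ m"
  by (auto simp: agree_def less_Suc_eq)

lemma agree_Suc_X_power: "agree (Suc m) f (fps_X ^ m) \<longleftrightarrow> agree m f 0 \<and> f $ m = 1"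
  and agree_Suc_one_plus_X_power: "m > 0 \<Longrightarrow>
    agree (Suc m) f (1 + fps_X ^ m) \<longleftrightarrow> agree m f 1 \<and> f $ m = 1"
  for f :: "'a::comm_ring_1 fps"
  by (auto simp: agree_def less_Suc_eq)

lemma agree_1_double_iff:
  assumes "n \<ge> 2"
  shows "agree (2 * n) f (1::'a::comm_ring_1 fps) \<longleftrightarrow>
    agree (2 * n - 2) f 1 \<and> f $ (2 * n - 2) = 0 \<and> f $ (2 * n - 1) = 0"
proof (cases n)
  case (Suc l)
  then show ?thesis
    using assms by (simp add: agree_Suc)
qed (use assms in simp)

lemma agree_add: "agree m f f' \<Longrightarrow> agree m g g' \<Longrightarrow> agree m (f + g) (f' + g')"
  by (simp add: agree_def)

lemma agree_add_eq_0_iff: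
  fixes f g :: "bit fps"
  shows "agree m (f + g) 0 \<longleftrightarrow> agree m f g"
  by (simp add: agree_def bit_add_eq_0_iff)

lemma agree_mult:
  fixes f g :: "'a::comm_ring_1 fps"
  shows "agree m f f' \<Longrightarrow> agree m g g' \<Longrightarrow> agree m (f * g) (f' * g')"
  by (auto simp: agree_def fps_mult_nth intro!: sum.cong)

lemma agree_power:
  fixes f g :: "'a::comm_ring_1 fps"
  shows "agree m f g \<Longrightarrow> agree m (f ^ i) (g ^ i)"
  by (induction i) (auto intro: agree_mult)

lemma agree_compose:
  fixes f g x y :: "'a::comm_ring_1 fps"
  shows "agree m f g \<Longrightarrow> agree m x y \<Longrightarrow> agree m (f oo x) (g oo y)"
  unfolding agree_def fps_compose_nth
  by (auto intro!: sum.cong simp: agree_power[unfolded agree_def, rule_format, of m x y])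

lemma agree_mult_cancel:
  fixes r f g :: "'a::field fps"
  assumes "agree m (r * f) (r * g)" "r $ 0 \<noteq> 0"
  shows "agree m f g"
  using agree_mult[OF agree_refl[of m "inverse r"] assms(1)] inverse_mult_eq_1[OF assms(2)]
  by (simp flip: mult.assoc)

lemma agree_compose_cancel:
  fixes f g x :: "'a::field fps"
  assumes "agree m (f oo x) (g oo x)" "x $ 0 = 0" "x $ 1 \<noteq> 0"
  shows "agree m f g"
proof -
  have "fps_inv x $ 0 = 0"
    by (simp add: fps_inv_def)
  then have "f = (f oo x) oo fps_inv x" "g = (g oo x) oo fps_inv x"
    using assms(2,3) by (simp_all flip: fps_compose_assoc add: fps_inv_right)
  then show ?thesis
    using agree_compose[OF assms(1) agree_refl[of m "fps_inv x"]] by simp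
qed

lemma agree_0_iff:
  fixes f :: "'a::comm_ring_1 fps"
  shows "agree m f 0 \<longleftrightarrow> f = fps_X ^ m * fps_shift m f"
proof
  assume "agree m f 0"
  then show "f = fps_X ^ m * fps_shift m f"
    by (intro fps_ext) (auto simp: fps_X_power_mult_nth agree_def)
next
  assume f: "f = fps_X ^ m * fps_shift m f"
  show "agree m f 0"
    by (subst f) (simp add: agree_def fps_X_power_mult_nth)
qed

lemma agree_0_mult:
  fixes f g :: "'a::comm_ring_1 fps"
  assumes "agree m f 0" "agree k g 0"
  shows "agree (m + k) (f * g) 0"
proof -
  have "f * g = (fps_X ^ m * fps_shift m f) * (fps_X ^ k * fps_shift k g)"
    using assms unfolding agree_0_iff by (rule arg_cong2)
  also have "\<dots> = fps_X ^ (m + k) * (fps_shift m f * fps_shift k g)"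
    by (simp add: power_add mult_ac)
  finally show ?thesis
    by (simp add: agree_def fps_X_power_mult_nth)
qed

lemma agree_0_compose:
  fixes f x :: "'a::idom fps"
  assumes "agree m f 0"
  shows "agree m (f oo x) 0"
  using agree_compose[OF assms agree_refl, of x] by simp

lemma agree_mult_unit:
  fixes a u :: "'a::comm_ring_1 fps"
  assumes "agree k a 1" "agree m u 0"
  shows "agree (k + m) (a * u) u"
proof -
  have "agree k (a - 1) 0"
    using assms(1) by (simp add: agree_def)
  from agree_0_mult[OF this assms(2)] show ?thesis
    by (simp add: agree_def algebra_simps)
qed

lemma agree_mult_near_1:
  fixes a b :: "bit fps"
  assumes "agree m a 1" "agree m b 1"
  shows "agree (2 * m) (a * b) (a + b + 1)"
proof -
  have "agree (m + m) ((a + 1) * (b + 1)) 0"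
    using assms by (intro agree_0_mult) (simp_all add: agree_add_eq_0_iff)
  also have "(a + 1) * (b + 1) = a * b + (a + b + 1)"
    by (simp add: algebra_simps)
  finally show ?thesis
    by (simp only: agree_add_eq_0_iff flip: mult_2)
qed

lemma mult_nth_lead:
  fixes r u :: "'a::comm_ring_1 fps"
  assumes "agree m u 0"
  shows "(r * u) $ m = r $ 0 * u $ m"
    and "(r * u) $ Suc m = r $ 0 * u $ Suc m + r $ 1 * u $ m"
proof -
  have "r * u = fps_X ^ m * (r * fps_shift m u)"
    using assms by (metis agree_0_iff mult.left_commute)
  then have shift: "(r * u) $ (m + j) = (r * fps_shift m u) $ j" for j
    by (simp add: fps_X_power_mult_nth)
  show "(r * u) $ m = r $ 0 * u $ m"
    using shift[of 0] by simp
  show "(r * u) $ Suc m = r $ 0 * u $ Suc m + r $ 1 * u $ m"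
    using shift[of 1] by simp
qed

lemma compose_nth_1:
  fixes u h :: "'a::comm_ring_1 fps"
  shows "(u oo h) $ Suc 0 = u $ Suc 0 * h $ Suc 0"
  by (simp add: fps_compose_nth)

lemma compose_nth_2_3:
  fixes u h :: "bit fps"
  assumes "h $ 0 = 0" "h $ 1 = 1"
  shows "(u oo h) $ 2 = u $ 2 + u $ 1 * h $ 2"
    and "(u oo h) $ 3 = u $ 3 + u $ 1 * h $ 3"
  using assms by (simp_all add: fps_compose_nth fps_mult_nth eval_nat_numeral algebra_simps)

lemma compose_nth_shift:
  fixes u h :: "'a::idom fps"
  assumes "agree m u 0" "h $ 0 = 0"
  shows "(u oo h) $ (m + j) = (fps_shift 1 h ^ m * (fps_shift m u oo h)) $ j"
proof -
  have "h = fps_X * fps_shift 1 h"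
    using assms(2) agree_0_iff[of 1 h] by (simp add: agree_def)
  then have h_power: "h ^ m = fps_X ^ m * fps_shift 1 h ^ m"
    by (metis power_mult_distrib)
  have "u oo h = (fps_X ^ m * fps_shift m u) oo h"
    using assms(1) unfolding agree_0_iff by (rule arg_cong)
  also have "\<dots> = h ^ m * (fps_shift m u oo h)"
    using assms(2) by (simp add: fps_compose_mult_distrib flip: fps_compose_power)
  finally have "u oo h = fps_X ^ m * (fps_shift 1 h ^ m * (fps_shift m u oo h))"
    by (simp add: h_power mult_ac)
  then show ?thesis
    by (simp add: fps_X_power_mult_nth)
qed

lemma compose_nth_lead:
  fixes u h :: "'a::idom fps"
  assumes "agree m u 0" "h $ 0 = 0" "h $ 1 = 1"
  shows "(u oo h) $ m = u $ m"
    and "(u oo h) $ Suc m = u $ Suc m + of_nat m * h $ 2 * u $ m"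
proof -
  have "(fps_shift 1 h ^ m) $ 0 = 1" "(fps_shift 1 h ^ m) $ 1 = of_nat m * h $ 2"
    using assms(3) fps_power_first_eq[of "fps_shift 1 h" m]
    by (simp_all add: fps_power_zeroth_eq_one numeral_2_eq_2)
  then show "(u oo h) $ m = u $ m"
    and "(u oo h) $ Suc m = u $ Suc m + of_nat m * h $ 2 * u $ m"
    using compose_nth_shift[OF assms(1,2), of 0] compose_nth_shift[OF assms(1,2), of 1] assms(3)
    by (simp_all add: compose_nth_1 fps_mult_nth)
qed

lemma bit_fps_square_nth:
  fixes p :: "bit fps"
  shows "(p\<^sup>2) $ k = (if even k then p $ (k div 2) else 0)"
proof (induction k arbitrary: p rule: induct_nat_012)
  case (ge2 k)
  define c where "c = fps_const (p $ 0)"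
  have "p = c + fps_X * fps_shift 1 p"
    by (rule fps_ext) (simp add: c_def)
  then have "p\<^sup>2 = (c + fps_X * fps_shift 1 p)\<^sup>2"
    by simp
  also have "\<dots> = c + fps_X\<^sup>2 * (fps_shift 1 p)\<^sup>2"
    by (simp add: c_def power2_eq_square algebra_simps)
  finally have "(p\<^sup>2) $ Suc (Suc k) = ((fps_shift 1 p)\<^sup>2) $ k"
    by (simp add: fps_X_power_mult_nth c_def)
  with ge2(1) show ?case by simp
qed (simp_all add: power2_eq_square)

lemma agree_square:
  fixes f g :: "bit fps"
  assumes "agree m f g"
  shows "agree (2 * m) (f\<^sup>2) (g\<^sup>2)"
  using assms by (auto simp: agree_def bit_fps_square_nth)

lemma agree_one_plus_power:
  fixes u :: "'a::comm_ring_1 fps"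
  assumes "agree k u 0"
  shows "agree (2 * k) ((1 + u) ^ l) (1 + of_nat l * u)"
proof (induction l)
  case (Suc l)
  have "agree (2 * k) (u * (of_nat l * u)) 0"
    using agree_mult[OF agree_refl[of _ "of_nat l"] agree_0_mult[OF assms assms]]
    by (simp add: mult_ac flip: mult_2)
  then have "agree (2 * k) ((1 + u) * (1 + of_nat l * u)) (1 + of_nat (Suc l) * u)"
    by (simp add: agree_def algebra_simps)
  with agree_mult[OF agree_refl Suc] show ?case
    by (auto intro: agree_trans)
qed simp

lemma even_power_nth_low:
  fixes p :: "bit fps"
  assumes "p $ 0 = 1"
  shows "(p ^ (2 * l)) $ 0 = 1" "(p ^ (2 * l)) $ 1 = 0"
    "(p ^ (2 * l)) $ 2 = of_nat l * p $ 1" "(p ^ (2 * l)) $ 3 = 0"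
proof -
  have "agree 2 (p\<^sup>2 + 1) 0"
    using assms by (auto simp: agree_def bit_fps_square_nth less_2_cases_iff)
  from agree_one_plus_power[OF this, of l]
  have "agree 4 (p ^ (2 * l)) (1 + of_nat l * (p\<^sup>2 + 1))"
    by (simp add: add_ac power_mult)
  then have "(p ^ (2 * l)) $ k = (1 + fps_const (of_nat l) * (p\<^sup>2 + 1)) $ k" if "k < 4" for k
    using that by (simp add: agree_def fps_of_nat)
  moreover have "(p\<^sup>2) $ 0 = 1" "(p\<^sup>2) $ 1 = 0" "(p\<^sup>2) $ 2 = p $ 1" "(p\<^sup>2) $ 3 = 0"
    using assms by (simp_all add: bit_fps_square_nth)
  ultimately show "(p ^ (2 * l)) $ 0 = 1" "(p ^ (2 * l)) $ 1 = 0"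
    "(p ^ (2 * l)) $ 2 = of_nat l * p $ 1" "(p ^ (2 * l)) $ 3 = 0"
    by simp_all
qed

lemma compose_nth_even:
  fixes u h :: "bit fps"
  assumes "agree (2 * l) u 0" "h $ 0 = 0" "h $ 1 = 1"
  shows "(u oo h) $ (2 * l) = u $ (2 * l)"
    and "(u oo h) $ (2 * l + 1) = u $ (2 * l + 1)"
    and "(u oo h) $ (2 * l + 2) = u $ (2 * l + 2) +
      h $ 2 * (u $ (2 * l + 1) + of_nat l * u $ (2 * l))"
    and "(u oo h) $ (2 * l + 3) = u $ (2 * l + 3) + (h $ 3 + of_nat l * h $ 2) * u $ (2 * l + 1)"
proof -
  define H U where "H = fps_shift 1 h" and "U = fps_shift (2 * l) u oo h"
  have H_nth: "(H ^ (2 * l)) $ 0 = 1" "(H ^ (2 * l)) $ 1 = 0"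
    "(H ^ (2 * l)) $ 2 = of_nat l * h $ 2" "(H ^ (2 * l)) $ 3 = 0"
    using even_power_nth_low[of H l] assms(3) by (simp_all add: H_def numeral_2_eq_2)
  have U_nth: "U $ 0 = u $ (2 * l)" "U $ 1 = u $ (2 * l + 1)"
    "U $ 2 = u $ (2 * l + 2) + u $ (2 * l + 1) * h $ 2"
    "U $ 3 = u $ (2 * l + 3) + u $ (2 * l + 1) * h $ 3"
    using compose_nth_2_3[OF assms(2,3), of "fps_shift (2 * l) u"] assms(3)
    by (simp_all add: U_def compose_nth_1 add_ac)
  have nth: "(u oo h) $ (2 * l + j) = (\<Sum>i=0..j. (H ^ (2 * l)) $ i * U $ (j - i))" for j
    unfolding H_def U_def compose_nth_shift[OF assms(1,2)] fps_mult_nth ..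
  have intervals: "{0..1::nat} = {0,1}" "{0..2::nat} = {0,1,2}" "{0..3::nat} = {0,1,2,3}"
    by auto
  show "(u oo h) $ (2 * l) = u $ (2 * l)"
    using nth[of 0] H_nth U_nth by simp
  show "(u oo h) $ (2 * l + 1) = u $ (2 * l + 1)"
    using nth[of 1] H_nth U_nth unfolding intervals by simp
  show "(u oo h) $ (2 * l + 2) = u $ (2 * l + 2) +
    h $ 2 * (u $ (2 * l + 1) + of_nat l * u $ (2 * l))"
    using nth[of 2] H_nth U_nth unfolding intervals by (simp add: algebra_simps)
  show "(u oo h) $ (2 * l + 3) = u $ (2 * l + 3) + (h $ 3 + of_nat l * h $ 2) * u $ (2 * l + 1)"
    using nth[of 3] H_nth U_nth unfolding intervals by (simp add: algebra_simps)
qed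

lemma compose_agree_even:
  fixes u h :: "bit fps"
  assumes "agree (2 * l) u 0" "h $ 0 = 0" "h $ 1 = 1"
  shows "agree (2 * l + 2) (u oo h) u"
  using compose_nth_even(1,2)[OF assms] agree_0_compose[OF assms(1), of h] assms(1)
  by (simp add: agree_Suc) (simp add: agree_def)

lemma compose_agree_near_1:
  fixes u h :: "bit fps"
  assumes "agree (2 * n - 2) u 1" "h $ 0 = 0" "h $ 1 = 1"
  shows "agree (2 * n) (u oo h) u"
proof (cases n)
  case (Suc l)
  then have "agree (2 * l) (u + 1) 0"
    using assms(1) by (simp add: agree_add_eq_0_iff)
  from agree_add[OF compose_agree_even[OF this assms(2,3)] agree_refl[of _ 1]] show ?thesis
    by (simp add: Suc fps_compose_add_distrib add.assoc)
qed (simp add: agree_def)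

lemma compose_near_1_nth:
  fixes u h :: "bit fps"
  assumes n: "n \<ge> 2" and u: "agree (2 * n - 2) u 1" and h: "h $ 0 = 0" "h $ 1 = 1"
  shows "(u oo h) $ (2 * n) = u $ (2 * n) +
    h $ 2 * (u $ (2 * n - 1) + of_nat (n - 1) * u $ (2 * n - 2))"
    and "(u oo h) $ (2 * n + 1) = u $ (2 * n + 1) +
      (h $ 3 + of_nat (n - 1) * h $ 2) * u $ (2 * n - 1)"
proof -
  obtain l where l: "n = Suc l" "l > 0"
    using n by (cases n) auto
  have "agree (2 * l) (u + 1) 0"
    using u by (simp add: agree_add_eq_0_iff l)
  from compose_nth_even(3,4)[OF this h]
  show "(u oo h) $ (2 * n) = u $ (2 * n) +
    h $ 2 * (u $ (2 * n - 1) + of_nat (n - 1) * u $ (2 * n - 2))"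
    and "(u oo h) $ (2 * n + 1) = u $ (2 * n + 1) +
      (h $ 3 + of_nat (n - 1) * h $ 2) * u $ (2 * n - 1)"
    using l by (simp_all add: fps_compose_add_distrib eval_nat_numeral)
qed

lemma X_power_compose_agree:
  fixes h :: "'a::idom fps"
  assumes "h $ 0 = 0" "h $ 1 = 1"
  shows "agree (Suc m) (fps_X ^ m oo h) (fps_X ^ m)"
proof -
  have order: "agree m (fps_X ^ m :: 'a fps) 0"
    by (simp add: agree_def)
  then have "agree m (fps_X ^ m oo h) (fps_X ^ m)"
    using agree_0_compose[OF order, of h] by (simp add: agree_def)
  then show ?thesis
    using compose_nth_lead(1)[OF order assms] by (simp add: agree_Suc)
qed

lemma X_plus_X_power_power_agree:
  "agree (m + 2 * k) ((fps_X + fps_X ^ Suc k) ^ m)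
    (fps_X ^ m + of_nat m * fps_X ^ (m + k) :: 'a::comm_ring_1 fps)"
proof -
  have "agree k (fps_X ^ k :: 'a fps) 0"
    by (simp add: agree_def)
  from agree_one_plus_power[OF this, of m]
  have "agree (2 * k) ((1 + fps_X ^ k) ^ m) (1 + of_nat m * fps_X ^ k :: 'a fps)" .
  then have "agree (m + 2 * k) (fps_X ^ m * (1 + fps_X ^ k) ^ m)
      (fps_X ^ m * (1 + of_nat m * fps_X ^ k) :: 'a fps)"
    by (auto simp: agree_def fps_X_power_mult_nth)
  then show ?thesis
    by (simp add: algebra_simps power_add flip: power_mult_distrib)
qed

lemma X_power_compose_X_plus_X_power:
  assumes "odd a"
  shows "agree (a + 2 * k) (fps_X ^ a oo (fps_X + fps_X ^ Suc k))
    (fps_X ^ a + fps_X ^ (a + k) :: bit fps)"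
proof -
  have "(of_nat a :: bit fps) = 1"
    using assms by (simp add: bit_of_nat flip: fps_of_nat)
  then show ?thesis
    using X_plus_X_power_power_agree[of a k, where 'a = bit] by (simp flip: fps_compose_power)
qed

lemma one_plus_X_power_compose_X_plus_X_power:
  assumes "odd a" "k > 0"
  shows "agree (Suc (a + k)) ((1 + fps_X ^ a) oo (fps_X + fps_X ^ Suc k))
    (1 + fps_X ^ a + fps_X ^ (a + k) :: bit fps)"
proof -
  have "agree (Suc (a + k)) (fps_X ^ a oo (fps_X + fps_X ^ Suc k))
      (fps_X ^ a + fps_X ^ (a + k) :: bit fps)"
    using X_power_compose_X_plus_X_power[OF assms(1), of k]
    by (rule agree_mono) (use assms(2) in simp)
  then have "agree (Suc (a + k)) (1 + (fps_X ^ a oo (fps_X + fps_X ^ Suc k)))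
      (1 + (fps_X ^ a + fps_X ^ (a + k)) :: bit fps)"
    by (intro agree_add agree_refl)
  then show ?thesis
    by (simp add: fps_compose_add_distrib add.assoc)
qed

lemma agree_quotient_one_plus_X_power:
  fixes S S' C :: "bit fps"
  assumes "agree (Suc m) (S' * C) S" "agree (Suc m) S' (S + fps_X ^ m)" "S $ 0 = 1" "m > 0"
  shows "agree (Suc m) C (1 + fps_X ^ m)"
proof -
  have S'0: "S' $ 0 = 1"
    using agreeD[OF assms(2), of 0] assms(3,4) by simp
  have order: "agree m (fps_X ^ m :: bit fps) 0"
    by (simp add: agree_def)
  have "agree 1 S' 1"
    using S'0 by (simp add: agree_def)
  from agree_mult_unit[OF this order] have "agree (Suc m) (S' * fps_X ^ m) (fps_X ^ m)"
    by simp
  from agree_add[OF agree_refl[of _ S'] this]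
  have "agree (Suc m) (S' * (1 + fps_X ^ m)) (S' + fps_X ^ m)"
    by (simp add: algebra_simps)
  also have "agree (Suc m) \<dots> (S + fps_X ^ m + fps_X ^ m)"
    by (intro agree_add agree_refl assms(2))
  also have "S + fps_X ^ m + fps_X ^ m = S"
    by (simp add: add.assoc)
  finally have "agree (Suc m) (S' * C) (S' * (1 + fps_X ^ m))"
    using assms(1) agree_sym agree_trans by blast
  then show ?thesis
    by (rule agree_mult_cancel) (simp add: S'0)
qed

lemma agree_compose_X_power_cancel:
  fixes c g :: "'a::field fps"
  assumes "agree (Suc m) (c oo g) (fps_const a + fps_X ^ m)" "g $ 0 = 0" "g $ 1 = 1"
  shows "agree (Suc m) c (fps_const a + fps_X ^ m)"
proof -
  have "agree (Suc m) (fps_const a + fps_X ^ m) ((fps_const a + fps_X ^ m) oo g)"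
    using agree_add[OF agree_refl X_power_compose_agree[OF assms(2,3)]]
    by (simp add: fps_compose_add_distrib agree_sym)
  with assms(1) have "agree (Suc m) (c oo g) ((fps_const a + fps_X ^ m) oo g)"
    by (rule agree_trans)
  then show ?thesis
    by (rule agree_compose_cancel) (use assms in simp_all)
qed

section \<open>Even and odd parts\<close>

definition even_part :: "'a fps \<Rightarrow> 'a fps" where
  "even_part f = Abs_fps (\<lambda>k. f $ (2 * k))"

definition odd_part :: "'a fps \<Rightarrow> 'a fps" where
  "odd_part f = Abs_fps (\<lambda>k. f $ (2 * k + 1))"

definition of_parts :: "'a::comm_ring_1 fps \<Rightarrow> 'a fps \<Rightarrow> 'a fps" where
  "of_parts P S = P\<^sup>2 + fps_X * S\<^sup>2"

lemma even_part_nth: "even_part f $ k = f $ (2 * k)"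
  by (simp add: even_part_def)

lemma odd_part_nth: "odd_part f $ k = f $ (2 * k + 1)"
  by (simp add: odd_part_def)

lemma agree_even_part: "agree (2 * m) f g \<Longrightarrow> agree m (even_part f) (even_part g)"
  and agree_odd_part: "agree (2 * m) f g \<Longrightarrow> agree m (odd_part f) (odd_part g)"
  by (simp_all add: agree_def even_part_nth odd_part_nth)

lemma even_part_X [simp]: "even_part fps_X = 0"
  by (rule fps_ext) (auto simp: even_part_nth)

lemma odd_part_X [simp]: "odd_part fps_X = 1"
  by (rule fps_ext) (auto simp: odd_part_nth)

lemma even_part_of_parts [simp]: "even_part (of_parts P S) = P"
  and odd_part_of_parts [simp]: "odd_part (of_parts P S) = S" for P S :: "bit fps"
  by (simp_all add: fps_eq_iff even_part_nth odd_part_nth of_parts_def bit_fps_square_nth)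

lemma of_parts_nth_0 [simp]: "of_parts P S $ 0 = P $ 0"
  and of_parts_nth_1 [simp]: "of_parts P S $ Suc 0 = S $ 0" for P S :: "bit fps"
  by (simp_all add: of_parts_def bit_fps_square_nth)

lemma of_parts_even_odd [simp]: "of_parts (even_part f) (odd_part f) = f" for f :: "bit fps"
proof (rule fps_ext)
  fix k show "of_parts (even_part f) (odd_part f) $ k = f $ k"
    by (cases k) (auto simp: of_parts_def bit_fps_square_nth even_part_nth odd_part_nth)
qed

lemma of_parts_compose:
  fixes P S :: "'a::idom fps"
  assumes "h $ 0 = 0"
  shows "of_parts P S oo h = (P oo h)\<^sup>2 + h * (S oo h)\<^sup>2"
  using assms
  by (simp add: of_parts_def fps_compose_add_distrib fps_compose_mult_distrib fps_compose_power)

lemma X_plus_X_square_eq: "fps_X + fps_X\<^sup>2 = (of_parts fps_X 1 :: bit fps)"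
  by (simp add: of_parts_def add.commute)

lemma X_plus_X_cube_eq: "fps_X + fps_X ^ 3 = (of_parts 0 (1 + fps_X) :: bit fps)"
  by (simp add: of_parts_def power2_eq_square power3_eq_cube algebra_simps)

lemma odd_part_compose: "h $ 0 = 0 \<Longrightarrow> odd_part (f oo h) = odd_part h * (odd_part f oo h)"
  and even_part_compose: "h $ 0 = 0 \<Longrightarrow>
    even_part (f oo h) = (even_part f oo h) + even_part h * (odd_part f oo h)"
  for f h :: "bit fps"
proof -
  assume h: "h $ 0 = 0"
  let ?P = "even_part f oo h" and ?S = "odd_part f oo h"
  have "f oo h = of_parts (even_part f) (odd_part f) oo h"
    by simp
  also have "\<dots> = ?P\<^sup>2 + h * ?S\<^sup>2"
    using h by (rule of_parts_compose)
  also have "\<dots> = ?P\<^sup>2 + of_parts (even_part h) (odd_part h) * ?S\<^sup>2"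
    by simp
  also have "\<dots> = of_parts (?P + even_part h * ?S) (odd_part h * ?S)"
    by (simp add: of_parts_def power2_eq_square algebra_simps)
  finally have "f oo h = of_parts (?P + even_part h * ?S) (odd_part h * ?S)" .
  then show "odd_part (f oo h) = odd_part h * ?S" "even_part (f oo h) = ?P + even_part h * ?S"
    by simp_all
qed

lemma compose_near_X:
  fixes r x :: "bit fps"
  assumes x: "agree m x fps_X" and m: "m \<ge> 2"
  shows "agree (m + 2) (r oo x) (r + fps_const (r $ 1) * (x + fps_X))"
proof -
  let ?P = "even_part r" and ?S = "odd_part r"
  have x0: "x $ 0 = 0"
    using agreeD[OF x, of 0] m by simp
  have "agree m (u oo x) u" for u
    using agree_compose[OF agree_refl x, of u] by simp
  then have square: "agree (2 * m) ((u oo x)\<^sup>2) (u\<^sup>2)" for u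
    by (rule agree_square)
  have "r oo x = of_parts ?P ?S oo x"
    by simp
  also have "\<dots> = (?P oo x)\<^sup>2 + x * (?S oo x)\<^sup>2"
    using x0 by (rule of_parts_compose)
  also have "agree (2 * m) \<dots> (?P\<^sup>2 + x * ?S\<^sup>2)"
    by (intro agree_add agree_mult square agree_refl)
  also have "?P\<^sup>2 + x * ?S\<^sup>2 = of_parts ?P ?S + (x + fps_X) * ?S\<^sup>2"
    unfolding of_parts_def by (simp add: algebra_simps)
  finally have "agree (2 * m) (r oo x) (r + (x + fps_X) * ?S\<^sup>2)"
    by simp
  then have rx: "agree (m + 2) (r oo x) (r + (x + fps_X) * ?S\<^sup>2)"
    by (rule agree_mono) (use m in simp)
  have "agree 2 (?S\<^sup>2) (fps_const (r $ 1))"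
    by (auto simp: agree_def bit_fps_square_nth odd_part_nth less_2_cases_iff)
  then have "agree (m + 2) ((x + fps_X) * (?S\<^sup>2 + fps_const (r $ 1))) 0"
    using x by (intro agree_0_mult) (simp_all add: agree_add_eq_0_iff)
  moreover have "(x + fps_X) * (?S\<^sup>2 + fps_const (r $ 1)) =
    (x + fps_X) * ?S\<^sup>2 + fps_const (r $ 1) * (x + fps_X)"
    by (simp add: algebra_simps)
  ultimately have "agree (m + 2) ((x + fps_X) * ?S\<^sup>2) (fps_const (r $ 1) * (x + fps_X))"
    by (simp only: agree_add_eq_0_iff)
  from agree_trans[OF rx agree_add[OF agree_refl this]] show ?thesis .
qed

definition near_X :: "nat \<Rightarrow> nat \<Rightarrow> bit fps \<Rightarrow> bool" where
  "near_X m j f \<longleftrightarrow> f $ 0 = 0 \<and> f $ 1 = 1 \<and> agree m (even_part f) 0 \<and> agree j (odd_part f) 1"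

lemma near_X_fps_X [simp]: "near_X m j fps_X"
  by (simp add: near_X_def)

lemma near_X_mono: "near_X m j f \<Longrightarrow> m' \<le> m \<Longrightarrow> j' \<le> j \<Longrightarrow> near_X m' j' f"
  by (auto simp: near_X_def intro: agree_mono)

lemma near_X_Suc_even: "near_X (Suc m) j f \<longleftrightarrow> near_X m j f \<and> even_part f $ m = 0"
  and near_X_Suc_odd: "j > 0 \<Longrightarrow> near_X m (Suc j) f \<longleftrightarrow> near_X m j f \<and> odd_part f $ j = 0"
  by (auto simp: near_X_def agree_Suc)

lemma near_X_agree_X:
  assumes "near_X m j f" "k \<le> 2 * m" "k \<le> max 3 (2 * j + 1)"
  shows "agree k f fps_X"
  unfolding agree_def
proof safe
  fix i assume "i < k"
  show "f $ i = fps_X $ i"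
  proof (cases "even i")
    case True
    then obtain l where l: "i = 2 * l" by (elim evenE)
    then have "even_part f $ l = 0"
      using assms \<open>i < k\<close> by (simp add: near_X_def agree_def)
    then show ?thesis
      by (simp add: l even_part_nth)
  next
    case False
    then obtain l where l: "i = 2 * l + 1" by (elim oddE)
    then have "odd_part f $ l = (if l = 0 then 1 else 0)"
      using assms \<open>i < k\<close> by (cases "l = 0") (auto simp: near_X_def agree_def odd_part_nth)
    then show ?thesis
      by (simp add: l odd_part_nth)
  qed
qed

lemma
  assumes f: "near_X m j f" and h: "near_X m j h"
  shows near_X_compose_closed: "near_X m j (f oo h)"
    and even_part_compose_lead: "even_part (f oo h) $ m = even_part f $ m + even_part h $ m"
    and odd_part_compose_lead: "j > 0 \<Longrightarrow> odd_part (f oo h) $ j = odd_part f $ j + odd_part h $ j"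
proof -
  have h01: "h $ 0 = 0" "h $ 1 = 1"
    using h by (simp_all add: near_X_def)
  let ?P = "even_part f oo h" and ?S = "odd_part f oo h"
  have even_f: "agree m (even_part f) 0" and even_h: "agree m (even_part h) 0"
    and odd_f: "agree j (odd_part f + 1) 0" and odd_h: "agree j (odd_part h) 1"
    using f h by (simp_all add: near_X_def agree_add_eq_0_iff)
  have "(odd_part f + 1) oo h = ?S + 1"
    by (simp add: fps_compose_add_distrib)
  with agree_0_compose[OF odd_f, of h] compose_nth_lead(1)[OF odd_f h01]
  have S: "agree j ?S 1" "?S $ j = odd_part f $ j"
    by (simp_all add: agree_add_eq_0_iff)
  have S0: "odd_part f $ 0 = 1"
    using f by (simp add: near_X_def odd_part_nth)
  have odd_fh: "odd_part (f oo h) = odd_part h * ?S"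
    and even_fh: "even_part (f oo h) = ?P + ?S * even_part h"
    using h01 by (simp_all add: odd_part_compose even_part_compose)
  have P: "agree m ?P 0"
    using even_f by (rule agree_0_compose)
  have Sh: "agree m (?S * even_part h) 0"
    using agree_mult[OF agree_refl even_h, of ?S] by simp
  have "(f oo h) $ 0 = 0" "(f oo h) $ 1 = 1"
    using f h by (simp_all add: near_X_def compose_nth_1)
  moreover have "agree j (odd_part (f oo h)) 1"
    using agree_mult[OF odd_h S(1)] by (simp add: odd_fh)
  moreover have "agree m (even_part (f oo h)) 0"
    using agree_add[OF P Sh] by (simp add: even_fh)
  ultimately show "near_X m j (f oo h)"
    by (simp add: near_X_def)
  show "even_part (f oo h) $ m = even_part f $ m + even_part h $ m"
    by (simp add: even_fh compose_nth_lead(1)[OF even_f h01] mult_nth_lead(1)[OF even_h] S0)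
  show "odd_part (f oo h) $ j = odd_part f $ j + odd_part h $ j" if "j > 0"
    using agreeD[OF agree_mult_near_1[OF odd_h S(1)], of j] that S(2) by (simp add: odd_fh add_ac)
qed

section \<open>Kernels, quotients and finite cyclic groups\<close>

lemma (in group)
  assumes H: "subgroup H G" and K: "group K" and \<phi>: "\<phi> \<in> hom (G\<lparr>carrier := H\<rparr>) K"
  shows subgroup_kernel_restrict: "subgroup (kernel (G\<lparr>carrier := H\<rparr>) K \<phi>) G"
    and FactGroup_kernel_restrict_iso: "\<phi> ` H = carrier K \<Longrightarrow>
      (G\<lparr>carrier := H\<rparr>) Mod kernel (G\<lparr>carrier := H\<rparr>) K \<phi> \<cong> K"
proof -
  interpret \<phi>: group_hom "G\<lparr>carrier := H\<rparr>" K \<phi>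
    by (intro group_hom.intro group_hom_axioms.intro subgroup_imp_group H K \<phi>)
  show "subgroup (kernel (G\<lparr>carrier := H\<rparr>) K \<phi>) G"
    by (rule incl_subgroup[OF H \<phi>.subgroup_kernel])
  show "(G\<lparr>carrier := H\<rparr>) Mod kernel (G\<lparr>carrier := H\<rparr>) K \<phi> \<cong> K" if "\<phi> ` H = carrier K"
    using that by (intro \<phi>.FactGroup_iso) simp
qed

lemma (in group_hom) the_elem_image_kernel_rcoset:
  assumes "x \<in> carrier G"
  shows "the_elem (h ` (kernel G H h #> x)) = h x"
proof -
  have "h ` (kernel G H h #> x) = {h x}"
    using assms by (force simp: r_coset_def kernel_def image_iff intro: bexI[of _ \<one>])
  then show ?thesis
    by simp
qed

lemma iso_ord_eq:
  assumes "\<phi> \<in> iso G H" "group G" "group H" "x \<in> carrier G"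
  shows "group.ord G x = group.ord H (\<phi> x)"
proof -
  interpret group_hom G H \<phi>
    using assms by (intro group_hom.intro group_hom_axioms.intro) (auto simp: iso_def)
  have inj: "inj_on \<phi> (carrier G)"
    using assms(1) by (simp add: iso_def bij_betw_def)
  have "\<phi> x [^]\<^bsub>H\<^esub> n = \<one>\<^bsub>H\<^esub> \<longleftrightarrow> x [^]\<^bsub>G\<^esub> n = \<one>\<^bsub>G\<^esub>" for n :: nat
    using inj_onD[OF inj, of "x [^]\<^bsub>G\<^esub> n" "\<one>\<^bsub>G\<^esub>"] assms(4) by (auto simp: hom_nat_pow[symmetric])
  then show ?thesis
    using G.ord_unique[OF assms(4)] H.pow_eq_id assms(4) hom_closed by metis
qed

lemma comm_group_DirProd:
  assumes "comm_group G" "comm_group H"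
  shows "comm_group (G \<times>\<times> H)"
proof -
  interpret G: comm_group G by fact
  interpret H: comm_group H by fact
  show ?thesis
    by (rule group.group_comm_groupI[OF DirProd_group])
      (auto simp: G.is_group H.is_group G.m_comm H.m_comm)
qed

lemma one_Zmod [simp]: "\<one>\<^bsub>Zmod n\<^esub> = 0"
  and mult_Zmod [simp]: "x \<otimes>\<^bsub>Zmod n\<^esub> y = (x + y) mod int n"
  and comm_group_Zmod [simp]: "comm_group (Zmod n)"
  by (simp_all add: Zmod_def)

lemma group_Zmod [simp]: "group (Zmod n)"
  by (simp add: Zmod_def)

lemma carrier_Zmod: "n > 0 \<Longrightarrow> carrier (Zmod n) = {0..<int n}"
  by (simp add: Zmod_def carrier_integer_mod_group)

lemma carrier_Zmod_2: "carrier (Zmod 2) = range of_bit"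
proof -
  have "{0..<2} = {0, 1 :: int}"
    by auto
  then show ?thesis
    by (auto simp: carrier_Zmod image_iff of_bool_def intro: exI[of _ 0] exI[of _ 1])
qed

lemma carrier_Zmod_4: "carrier (Zmod 4) = {of_bit a + 2 * of_bit b |a b. True}"
proof -
  have "{0..<4} = {0, 1, 2, 3 :: int}"
    by auto
  moreover have "{of_bit a + 2 * of_bit b |a b. True} = {0, 1, 2, 3 :: int}"
    by (auto simp: of_bool_def intro: exI[of _ 0] exI[of _ 1])
  ultimately show ?thesis
    by (simp add: carrier_Zmod)
qed

lemma of_bit_hom:
  assumes "\<And>x y. x \<in> carrier G \<Longrightarrow> y \<in> carrier G \<Longrightarrow> \<chi> (x \<otimes>\<^bsub>G\<^esub> y) = \<chi> x + \<chi> y"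
  shows "(\<lambda>x. of_bit (\<chi> x)) \<in> hom G (Zmod 2)"
proof (rule homI)
  have add: "(of_bit (a + b) :: int) = (of_bit a + of_bit b) mod 2" for a b
    by (cases a; cases b) simp_all
  show "of_bit (\<chi> (x \<otimes>\<^bsub>G\<^esub> y)) = of_bit (\<chi> x) \<otimes>\<^bsub>Zmod 2\<^esub> of_bit (\<chi> y)"
    if "x \<in> carrier G" "y \<in> carrier G" for x y
    unfolding assms[OF that] add by simp
qed (simp add: carrier_Zmod_2)

lemma of_bit_carry_hom:
  assumes "\<And>x y. x \<in> carrier G \<Longrightarrow> y \<in> carrier G \<Longrightarrow> \<chi> (x \<otimes>\<^bsub>G\<^esub> y) = \<chi> x + \<chi> y"
    and "\<And>x y. x \<in> carrier G \<Longrightarrow> y \<in> carrier G \<Longrightarrow> \<psi> (x \<otimes>\<^bsub>G\<^esub> y) = \<psi> x + \<psi> y + \<chi> x * \<chi> y"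
  shows "(\<lambda>x. of_bit (\<chi> x) + 2 * of_bit (\<psi> x)) \<in> hom G (Zmod 4)"
proof (rule homI)
  have add: "(of_bit (a + b) + 2 * of_bit (c + d + a * b) :: int)
      = (of_bit a + 2 * of_bit c + (of_bit b + 2 * of_bit d)) mod 4" for a b c d
    by (cases a; cases b; cases c; cases d) simp_all
  show "of_bit (\<chi> (x \<otimes>\<^bsub>G\<^esub> y)) + 2 * of_bit (\<psi> (x \<otimes>\<^bsub>G\<^esub> y))
      = (of_bit (\<chi> x) + 2 * of_bit (\<psi> x)) \<otimes>\<^bsub>Zmod 4\<^esub> (of_bit (\<chi> y) + 2 * of_bit (\<psi> y))"
    if "x \<in> carrier G" "y \<in> carrier G" for x y
    unfolding assms(1)[OF that] assms(2)[OF that] add by simp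
qed (auto simp: carrier_Zmod_4)

section \<open>The Riordan group and its closed subgroups\<close>

lemma riordan_carrier_iff [simp]: "(g, f) \<in> riordan_carrier \<longleftrightarrow> g $ 0 = 1 \<and> f $ 0 = 0 \<and> f $ 1 = 1"
  by (simp add: riordan_carrier_def)

lemma carrier_Riordan [simp]: "carrier Riordan = riordan_carrier"
  and one_Riordan [simp]: "\<one>\<^bsub>Riordan\<^esub> = (1, fps_X)"
  and mult_Riordan [simp]: "(g1, f1) \<otimes>\<^bsub>Riordan\<^esub> (g2, f2) = (g1 * (g2 oo f1), f2 oo f1)"
  by (simp_all add: Riordan_def)

lemma group_Riordan: "group Riordan"
proof (rule groupI)
  fix x y assume "x \<in> carrier Riordan" "y \<in> carrier Riordan"
  then show "x \<otimes>\<^bsub>Riordan\<^esub> y \<in> carrier Riordan"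
    by (cases x; cases y) (simp add: compose_nth_1)
next
  fix x y z
  assume "x \<in> carrier Riordan" "y \<in> carrier Riordan" "z \<in> carrier Riordan"
  then show "x \<otimes>\<^bsub>Riordan\<^esub> y \<otimes>\<^bsub>Riordan\<^esub> z = x \<otimes>\<^bsub>Riordan\<^esub> (y \<otimes>\<^bsub>Riordan\<^esub> z)"
    by (cases x; cases y; cases z) (simp add: fps_compose_mult_distrib fps_compose_assoc mult.assoc)
next
  fix x assume "x \<in> carrier Riordan"
  then obtain g f where x: "x = (g, f)" and gf: "g $ 0 = 1" "f $ 0 = 0" "f $ 1 = 1"
    by (cases x) simp
  define h where "h = fps_inv f"
  have "(inverse (g oo h), h) \<otimes>\<^bsub>Riordan\<^esub> x = \<one>\<^bsub>Riordan\<^esub>"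
    using gf by (simp add: x h_def fps_inv_right inverse_mult_eq_1)
  moreover have "(inverse (g oo h), h) \<in> carrier Riordan"
    using gf by (simp add: h_def fps_inv_def)
  ultimately show "\<exists>y\<in>carrier Riordan. y \<otimes>\<^bsub>Riordan\<^esub> x = \<one>\<^bsub>Riordan\<^esub>"
    by blast
qed (auto simp del: riordan_carrier_iff, simp_all)

interpretation Riordan: group Riordan
  rewrites "carrier Riordan = riordan_carrier" and "\<one>\<^bsub>Riordan\<^esub> = (1, fps_X)"
  by (rule group_Riordan) simp_all

lemma Nottingham_iff: "(g, f) \<in> Nottingham \<longleftrightarrow> g = 1 \<and> f $ 0 = 0 \<and> f $ 1 = 1"
  by (auto simp: Nottingham_def)

lemma Nottingham_subset: "Nottingham \<subseteq> riordan_carrier"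
  by (auto simp: Nottingham_iff)

lemma subgroup_Nottingham: "subgroup Nottingham Riordan"
proof (rule Riordan.subgroupI)
  show "Nottingham \<noteq> {}"
    using Nottingham_iff[of 1 fps_X] by auto
next
  fix x assume "x \<in> Nottingham"
  then obtain f where x: "x = (1, f)" and f: "f $ 0 = 0" "f $ 1 = 1"
    by (cases x) (auto simp: Nottingham_iff)
  define h where "h = fps_inv f"
  have h: "(1, h) \<in> Nottingham"
    using f by (simp add: h_def fps_inv_def Nottingham_iff)
  have "(1, h) \<otimes>\<^bsub>Riordan\<^esub> x = (1, fps_X)"
    using f by (simp add: x h_def fps_inv_right)
  then have "inv\<^bsub>Riordan\<^esub> x = (1, h)"
    using f h Nottingham_subset by (intro Riordan.inv_equality) (auto simp: x)
  then show "inv\<^bsub>Riordan\<^esub> x \<in> Nottingham"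
    using h by simp
next
  fix x y assume "x \<in> Nottingham" "y \<in> Nottingham"
  then show "x \<otimes>\<^bsub>Riordan\<^esub> y \<in> Nottingham"
    by (cases x; cases y) (auto simp: Nottingham_iff compose_nth_1)
qed (rule Nottingham_subset)

lemma Appell_m_iff: "(g, f) \<in> Appell_m m \<longleftrightarrow> f = fps_X \<and> g $ 0 = 1 \<and> agree (Suc m) g 1"
proof -
  have "(\<forall>k. 1 \<le> k \<and> k \<le> m \<longrightarrow> g $ k = 0) \<longleftrightarrow> agree (Suc m) g 1" if "g $ 0 = 1"
    using that by (auto simp: agree_def less_Suc_eq_le Suc_le_eq)
  then show ?thesis
    by (auto simp: Appell_m_def Appell_def)
qed

lemma Appell_m_subset: "Appell_m m \<subseteq> riordan_carrier"
  by (auto simp: Appell_m_iff)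

lemma subgroup_Appell_m: "subgroup (Appell_m m) Riordan"
proof (rule Riordan.subgroupI)
  show "Appell_m m \<noteq> {}"
    using Appell_m_iff[of 1 fps_X m] by auto
next
  fix x assume "x \<in> Appell_m m"
  then obtain g where x: "x = (g, fps_X)" and g: "g $ 0 = 1" "agree (Suc m) g 1"
    by (cases x) (auto simp: Appell_m_iff)
  have "(inverse g, fps_X) \<otimes>\<^bsub>Riordan\<^esub> x = (1, fps_X)"
    using g by (simp add: x inverse_mult_eq_1)
  then have "inv\<^bsub>Riordan\<^esub> x = (inverse g, fps_X)"
    using g by (intro Riordan.inv_equality) (simp_all add: x)
  moreover have "agree (Suc m) (g * inverse g) (g * 1)"
    using g by (simp add: inverse_mult_eq_1' agree_sym)
  then have "agree (Suc m) (inverse g) 1"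
    by (rule agree_mult_cancel) (simp add: g)
  ultimately show "inv\<^bsub>Riordan\<^esub> x \<in> Appell_m m"
    using g by (simp add: Appell_m_iff)
next
  fix x y assume "x \<in> Appell_m m" "y \<in> Appell_m m"
  then show "x \<otimes>\<^bsub>Riordan\<^esub> y \<in> Appell_m m"
    using agree_mult[of "Suc m" "fst x" 1 "fst y" 1] by (cases x; cases y) (auto simp: Appell_m_iff)
qed (rule Appell_m_subset)

lemma Appell_m_normal: "Appell_m m \<lhd> Riordan"
  unfolding Riordan.normal_inv_iff
proof (intro conjI subgroup_Appell_m ballI)
  fix x h assume x: "x \<in> riordan_carrier" and "h \<in> Appell_m m"
  then obtain g where h: "h = (g, fps_X)" and g: "g $ 0 = 1" "agree (Suc m) g 1"
    by (cases h) (auto simp: Appell_m_iff)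
  obtain a b where ab: "x = (a, b)" "b $ 0 = 0"
    using x by (cases x) auto
  have conj: "x \<otimes>\<^bsub>Riordan\<^esub> h = (g oo b, fps_X) \<otimes>\<^bsub>Riordan\<^esub> x"
    using ab by (simp add: h mult_ac)
  have "x \<otimes>\<^bsub>Riordan\<^esub> h \<otimes>\<^bsub>Riordan\<^esub> inv\<^bsub>Riordan\<^esub> x = (g oo b, fps_X)"
    unfolding conj using x g by (simp add: Riordan.m_assoc)
  moreover have "agree (Suc m) (g oo b) 1"
    using agree_compose[OF g(2) agree_refl, of b] by simp
  ultimately show "x \<otimes>\<^bsub>Riordan\<^esub> h \<otimes>\<^bsub>Riordan\<^esub> inv\<^bsub>Riordan\<^esub> x \<in> Appell_m m"
    using g by (simp add: Appell_m_iff)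
qed

lemma rclosure_iff:
  "x \<in> rclosure S \<longleftrightarrow> x \<in> riordan_carrier \<and>
    (\<forall>N. \<exists>h\<in>S. agree N (fst h) (fst x) \<and> agree N (snd h) (snd x))"
proof -
  have "(\<forall>k\<le>N. fst h $ k = fst x $ k \<and> snd h $ k = snd x $ k) \<longleftrightarrow>
      agree (Suc N) (fst h) (fst x) \<and> agree (Suc N) (snd h) (snd x)" for N h
    by (auto simp: agree_def less_Suc_eq_le)
  then have "x \<in> rclosure S \<longleftrightarrow> x \<in> riordan_carrier \<and>
      (\<forall>N. \<exists>h\<in>S. agree (Suc N) (fst h) (fst x) \<and> agree (Suc N) (snd h) (snd x))"
    by (auto simp: rclosure_def)
  then show ?thesis
    by (meson agree_mono le_SucI order_refl)
qed

lemma rclosure_eqI: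
  assumes "S \<subseteq> riordan_carrier"
    and "\<And>x. x \<in> riordan_carrier \<Longrightarrow>
      (\<And>N. \<exists>h\<in>S. agree N (fst h) (fst x) \<and> agree N (snd h) (snd x)) \<Longrightarrow> x \<in> S"
  shows "rclosure S = S"
proof
  show "S \<subseteq> rclosure S"
    using assms(1) by (auto simp: rclosure_def)
  show "rclosure S \<subseteq> S"
  proof
    fix x assume "x \<in> rclosure S"
    then show "x \<in> S"
      unfolding rclosure_iff by (elim conjE) (rule assms(2), simp_all)
  qed
qed

lemma rclosure_Int:
  assumes "rclosure S = S" "rclosure T = T"
  shows "rclosure (S \<inter> T) = S \<inter> T"
proof (rule rclosure_eqI)
  show "S \<inter> T \<subseteq> riordan_carrier"
    using assms by (auto simp: rclosure_def)
  fix x assume "x \<in> riordan_carrier"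
    and "\<And>N. \<exists>h\<in>S \<inter> T. agree N (fst h) (fst x) \<and> agree N (snd h) (snd x)"
  then have "x \<in> rclosure S" "x \<in> rclosure T"
    unfolding rclosure_iff by blast+
  then show "x \<in> S \<inter> T"
    using assms by simp
qed

lemma rclosure_Nottingham: "rclosure Nottingham = Nottingham"
proof (rule rclosure_eqI[OF Nottingham_subset])
  fix x assume x: "x \<in> riordan_carrier"
    and approx: "\<And>N. \<exists>h\<in>Nottingham. agree N (fst h) (fst x) \<and> agree N (snd h) (snd x)"
  have "fst x $ k = 1 $ k" for k
    using approx[of "Suc k"] by (auto simp: Nottingham_def agree_Suc)
  then have "fst x = 1"
    by (rule fps_ext)
  with x show "x \<in> Nottingham"
    by (cases x) (simp add: Nottingham_iff)
qed

lemma agree_inv_Riordan: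
  assumes k: "k \<in> riordan_carrier" and x: "x \<in> riordan_carrier"
    and kx: "k \<otimes>\<^bsub>Riordan\<^esub> x = (g, f)" "agree N g 1" "agree N f fps_X"
  shows "agree N (fst (inv\<^bsub>Riordan\<^esub> k)) (fst x)" "agree N (snd (inv\<^bsub>Riordan\<^esub> k)) (snd x)"
proof -
  have "inv\<^bsub>Riordan\<^esub> k \<in> riordan_carrier"
    using k by simp
  then obtain a b where ab: "inv\<^bsub>Riordan\<^esub> k = (a, b)" "b $ 0 = 0"
    by (cases "inv\<^bsub>Riordan\<^esub> k") auto
  have "inv\<^bsub>Riordan\<^esub> k \<otimes>\<^bsub>Riordan\<^esub> (k \<otimes>\<^bsub>Riordan\<^esub> x) = x"
    using k x by (simp flip: Riordan.m_assoc)
  then have x_eq: "fst x = a * (g oo b)" "snd x = f oo b"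
    by (auto simp: ab(1) kx(1))
  have "agree N (a * (g oo b)) (a * (1 oo b))" "agree N (f oo b) (fps_X oo b)"
    by (intro agree_mult agree_compose agree_refl kx(2,3))+
  then show "agree N (fst (inv\<^bsub>Riordan\<^esub> k)) (fst x)" "agree N (snd (inv\<^bsub>Riordan\<^esub> k)) (snd x)"
    by (simp_all add: x_eq ab agree_sym)
qed

lemma filtration_subset_closed_subgroup:
  assumes K: "subgroup K Riordan" "rclosure K = K" and D: "D 0 \<subseteq> riordan_carrier"
    and step: "\<And>i d. d \<in> D i \<Longrightarrow> \<exists>k\<in>K. k \<otimes>\<^bsub>Riordan\<^esub> d \<in> D (Suc i)"
    and small: "\<And>i g f. (g, f) \<in> D i \<Longrightarrow> agree i g 1 \<and> agree i f fps_X"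
  shows "D 0 \<subseteq> K"
proof
  fix x assume x: "x \<in> D 0"
  have K_carrier: "k \<in> K \<Longrightarrow> k \<in> riordan_carrier" for k
    using subgroup.mem_carrier[OF K(1)] by simp
  have x_carrier: "x \<in> riordan_carrier"
    using x D by blast
  have approximation: "\<exists>k\<in>K. k \<otimes>\<^bsub>Riordan\<^esub> x \<in> D i" for i
  proof (induction i)
    case 0
    then show ?case
      using x x_carrier subgroup.one_closed[OF K(1)] Riordan.l_one by force
  next
    case (Suc i)
    then obtain k where k: "k \<in> K" "k \<otimes>\<^bsub>Riordan\<^esub> x \<in> D i"
      by blast
    from step[OF k(2)] obtain k' where "k' \<in> K" "k' \<otimes>\<^bsub>Riordan\<^esub> (k \<otimes>\<^bsub>Riordan\<^esub> x) \<in> D (Suc i)"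
      by blast
    then show ?case
      using k(1) x_carrier K_carrier subgroup.m_closed[OF K(1)] by (metis Riordan.m_assoc)
  qed
  have "\<exists>h\<in>K. agree N (fst h) (fst x) \<and> agree N (snd h) (snd x)" for N
  proof -
    obtain k where k: "k \<in> K" "k \<otimes>\<^bsub>Riordan\<^esub> x \<in> D N"
      using approximation by blast
    obtain g f where gf: "k \<otimes>\<^bsub>Riordan\<^esub> x = (g, f)"
      by fastforce
    then have "agree N g 1" "agree N f fps_X"
      using small k(2) by simp_all
    from agree_inv_Riordan[OF K_carrier[OF k(1)] x_carrier gf this] show ?thesis
      using subgroup.m_inv_closed[OF K(1) k(1)] by blast
  qed
  then have "x \<in> rclosure K"
    using x_carrier by (simp add: rclosure_iff)
  then show "x \<in> K"
    by (simp add: K(2))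
qed

lemma closed_comm_eqI:
  assumes "subgroup D Riordan" "rclosure D = D"
    and "\<And>x y. x \<in> P \<Longrightarrow> y \<in> Q \<Longrightarrow> rcomm x y \<in> D"
    and "\<And>K. subgroup K Riordan \<Longrightarrow> rclosure K = K \<Longrightarrow> (\<And>x y. x \<in> P \<Longrightarrow> y \<in> Q \<Longrightarrow> rcomm x y \<in> K) \<Longrightarrow> D \<subseteq> K"
  shows "closed_comm P Q = D"
proof
  show "closed_comm P Q \<subseteq> D"
    unfolding closed_comm_def by (intro Inter_lower) (use assms(1-3) in auto)
  show "D \<subseteq> closed_comm P Q"
    unfolding closed_comm_def
  proof (rule Inter_greatest)
    fix K
    assume "K \<in> {K. subgroup K Riordan \<and> rclosure K = K \<and> {rcomm x y |x y. x \<in> P \<and> y \<in> Q} \<subseteq> K}"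
    then show "D \<subseteq> K"
      by (intro assms(4)) blast+
  qed
qed

section \<open>Commutators in the Nottingham group\<close>

definition nottingham_comm :: "bit fps \<Rightarrow> bit fps \<Rightarrow> bit fps" where
  "nottingham_comm x y = (y oo x) oo fps_inv (x oo y)"

lemma nottingham_comm_compose:
  assumes "x $ 0 = 0" "x $ 1 = 1" "y $ 0 = 0" "y $ 1 = 1"
  shows "nottingham_comm x y oo (x oo y) = y oo x"
proof -
  have "fps_inv (x oo y) $ 0 = 0" "(x oo y) $ 0 = 0" "(x oo y) $ 1 \<noteq> 0"
    using assms by (simp_all add: fps_inv_def compose_nth_1)
  then show ?thesis
    by (simp add: nottingham_comm_def fps_inv flip: fps_compose_assoc)
qed

lemma nottingham_comm_nth_0_1:
  assumes "x $ 0 = 0" "x $ 1 = 1" "y $ 0 = 0" "y $ 1 = 1"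
  shows "nottingham_comm x y $ 0 = 0" "nottingham_comm x y $ 1 = 1"
  using assms by (simp_all add: nottingham_comm_def fps_inv_def compose_nth_1)

lemma rcomm_closed: "x \<in> riordan_carrier \<Longrightarrow> y \<in> riordan_carrier \<Longrightarrow> rcomm x y \<in> riordan_carrier"
  by (simp add: rcomm_def)

lemma rcomm_eq:
  assumes "x \<in> riordan_carrier" "y \<in> riordan_carrier"
  shows "(y \<otimes>\<^bsub>Riordan\<^esub> x) \<otimes>\<^bsub>Riordan\<^esub> rcomm x y = x \<otimes>\<^bsub>Riordan\<^esub> y"
proof -
  have "rcomm x y = inv\<^bsub>Riordan\<^esub> (y \<otimes>\<^bsub>Riordan\<^esub> x) \<otimes>\<^bsub>Riordan\<^esub> (x \<otimes>\<^bsub>Riordan\<^esub> y)"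
    using assms by (simp add: rcomm_def Riordan.inv_mult_group Riordan.m_assoc)
  then show ?thesis
    using assms by (simp flip: Riordan.m_assoc)
qed

lemma rcomm_components:
  assumes x: "(g1, f1) \<in> riordan_carrier" and y: "(g2, f2) \<in> riordan_carrier"
  shows "snd (rcomm (g1, f1) (g2, f2)) = nottingham_comm f1 f2"
    and "g2 * (g1 oo f2) * (fst (rcomm (g1, f1) (g2, f2)) oo (f1 oo f2)) = g1 * (g2 oo f1)"
proof -
  obtain cg cf where c: "rcomm (g1, f1) (g2, f2) = (cg, cf)" by fastforce
  from rcomm_eq[OF x y]
  have components: "g2 * (g1 oo f2) * (cg oo (f1 oo f2)) = g1 * (g2 oo f1)"
    "cf oo (f1 oo f2) = f2 oo f1"
    by (simp_all add: c)
  then show "g2 * (g1 oo f2) * (fst (rcomm (g1, f1) (g2, f2)) oo (f1 oo f2)) = g1 * (g2 oo f1)"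
    by (simp add: c)
  have "(f1 oo f2) $ 0 = 0" "(f1 oo f2) $ 1 \<noteq> 0"
    using x y by (simp_all add: compose_nth_1)
  moreover have "cf oo (f1 oo f2) = nottingham_comm f1 f2 oo (f1 oo f2)"
    using components(2) x y by (simp add: nottingham_comm_compose)
  ultimately show "snd (rcomm (g1, f1) (g2, f2)) = nottingham_comm f1 f2"
    by (simp add: c fps_compose_inj_right)
qed

lemma rcomm_Nottingham:
  assumes "x $ 0 = 0" "x $ 1 = 1" "y $ 0 = 0" "y $ 1 = 1"
  shows "rcomm (1, x) (1, y) = (1, nottingham_comm x y)"
proof -
  have "rcomm (1, x) (1, y) \<in> Nottingham"
    using assms subgroup.m_closed[OF subgroup_Nottingham]
      subgroup.m_inv_closed[OF subgroup_Nottingham]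
    by (simp add: rcomm_def Nottingham_iff)
  then show ?thesis
    using rcomm_components(1)[of 1 x 1 y] assms
    by (cases "rcomm (1, x) (1, y)") (auto simp: Nottingham_iff)
qed

lemma
  fixes x y :: "bit fps"
  assumes x: "x $ 0 = 0" "x $ 1 = 1" and y: "y $ 0 = 0" "y $ 1 = 1"
  shows odd_part_nottingham_comm:
      "odd_part y * (odd_part x oo y) * (odd_part (nottingham_comm x y) oo (x oo y))
        = odd_part x * (odd_part y oo x)"
    and even_part_nottingham_comm:
      "(even_part (nottingham_comm x y) oo (x oo y))
          + ((even_part x oo y) + even_part y * (odd_part x oo y))
            * (odd_part (nottingham_comm x y) oo (x oo y))
        = (even_part y oo x) + even_part x * (odd_part y oo x)"
proof -
  let ?c = "nottingham_comm x y"
  have xy: "(x oo y) $ 0 = 0"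
    using x by simp
  have "odd_part (?c oo (x oo y)) = odd_part (y oo x)"
    and "even_part (?c oo (x oo y)) = even_part (y oo x)"
    using x y by (simp_all add: nottingham_comm_compose)
  then show "odd_part y * (odd_part x oo y) * (odd_part ?c oo (x oo y)) =
    odd_part x * (odd_part y oo x)"
    and "(even_part ?c oo (x oo y))
          + ((even_part x oo y) + even_part y * (odd_part x oo y)) * (odd_part ?c oo (x oo y))
        = (even_part y oo x) + even_part x * (odd_part y oo x)"
    unfolding odd_part_compose[OF xy] even_part_compose[OF xy] odd_part_compose[OF x(1)]
      even_part_compose[OF x(1)] odd_part_compose[OF y(1)] even_part_compose[OF y(1)] .
qed

lemma odd_part_nottingham_comm_agree_1:
  fixes x y :: "bit fps"
  assumes x: "near_X n (2 * n - 2) x" and y: "y $ 0 = 0" "y $ 1 = 1"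
  shows "agree (2 * n) (odd_part (nottingham_comm x y)) 1"
proof -
  define S r where "S = odd_part x" and "r = odd_part y"
  define C where "C = odd_part (nottingham_comm x y) oo (x oo y)"
  have x01: "x $ 0 = 0" "x $ 1 = 1" and S: "agree (2 * n - 2) S 1"
    using x by (simp_all add: near_X_def S_def)
  have xX: "agree (2 * n) x fps_X"
    by (rule near_X_agree_X[OF x]) auto
  have "agree (2 * n) (r * (S oo y) * 1) (r * S * 1)"
    by (intro agree_mult agree_refl compose_agree_near_1[OF S y])
  also have "r * S * 1 = S * (r oo fps_X)"
    by (simp add: mult.commute)
  also have "agree (2 * n) \<dots> (S * (r oo x))"
    by (intro agree_mult agree_compose agree_refl agree_sym[OF xX])
  also have "S * (r oo x) = r * (S oo y) * C"
    using odd_part_nottingham_comm[OF x01 y] by (simp add: S_def r_def C_def)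
  finally have "agree (2 * n) 1 C"
    by (rule agree_mult_cancel) (use x01 y in \<open>simp add: r_def S_def odd_part_nth\<close>)
  then have "agree (2 * n) (odd_part (nottingham_comm x y) oo (x oo y)) (1 oo (x oo y))"
    by (simp add: C_def agree_sym)
  then show ?thesis
    by (rule agree_compose_cancel) (use x01 y in \<open>simp_all add: compose_nth_1\<close>)
qed

lemma odd_part_nottingham_comm_agree:
  fixes x y :: "bit fps"
  assumes n: "n \<ge> 2" and x: "near_X n (2 * n - 2) x" and y: "y $ 0 = 0" "y $ 1 = 1"
  shows "agree (2 * n + 2) (odd_part y * (odd_part (nottingham_comm x y) + 1))
    (odd_part y * ((odd_part x oo y) + odd_part x) + fps_const (y $ 3) * (x + fps_X))"
proof -
  define S r where "S = odd_part x" and "r = odd_part y"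
  define c g where "c = odd_part (nottingham_comm x y)" and "g = x oo y"
  have x01: "x $ 0 = 0" "x $ 1 = 1" and S: "agree (2 * n - 2) S 1"
    using x by (simp_all add: near_X_def S_def)
  have g: "g $ 0 = 0" "g $ 1 = 1"
    using x01 y by (simp_all add: g_def compose_nth_1)
  have xX: "agree (2 * n) x fps_X"
    by (rule near_X_agree_X[OF x]) auto
  have near_1: "agree 2 S 1" "agree 2 (S oo y) 1"
    using agree_mono[OF S, of 2] agree_compose[OF agree_mono[OF S, of 2] agree_refl, of y] n
    by simp_all
  have rx_0: "agree (2 * n) ((r oo x) + r) 0"
    using agree_compose[OF agree_refl xX, of r] by (simp add: agree_add_eq_0_iff)
  have "r $ 1 = y $ 3"
    by (simp add: r_def odd_part_nth)
  then have rx: "agree (2 * n + 2) ((r oo x) + r) (fps_const (y $ 3) * (x + fps_X))"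
    using agree_add[OF compose_near_X[OF xX, of r] agree_refl[of _ r]] n by (simp add: add_ac)
  have c: "agree (2 * n) c 1"
    using odd_part_nottingham_comm_agree_1[OF x y] by (simp only: c_def)
  have cg_0: "agree (2 * n) ((c oo g) + 1) 0"
    using agree_compose[OF c agree_refl, of g] by (simp add: agree_add_eq_0_iff)
  have "agree (2 * (n + 1)) (c oo g) c"
    using c by (intro compose_agree_near_1 g) simp
  then have "agree (2 * n + 2) (c + 1) ((c oo g) + 1)"
    by (intro agree_add agree_refl) (simp add: agree_sym)
  also have "agree (2 * n + 2) ((c oo g) + 1) ((S oo y) * ((c oo g) + 1))"
    using agree_sym[OF agree_mult_unit[OF near_1(2) cg_0]] by (simp only: add.commute)
  finally have "agree (2 * n + 2) (r * (c + 1)) (r * ((S oo y) * ((c oo g) + 1)))"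
    by (intro agree_mult agree_refl)
  also have "r * ((S oo y) * ((c oo g) + 1)) = r * ((S oo y) + S) + S * ((r oo x) + r)"
    using odd_part_nottingham_comm[OF x01 y] by (simp add: S_def r_def c_def g_def algebra_simps)
  also have "agree (2 * n + 2) \<dots> (r * ((S oo y) + S) + ((r oo x) + r))"
    using agree_mult_unit[OF near_1(1) rx_0]
    by (intro agree_add agree_refl) (simp only: add.commute)
  also have "agree (2 * n + 2) \<dots> (r * ((S oo y) + S) + fps_const (y $ 3) * (x + fps_X))"
    by (intro agree_add agree_refl rx)
  finally show ?thesis
    by (simp only: S_def r_def c_def)
qed

lemma odd_part_nottingham_comm_nth:
  fixes x y :: "bit fps"
  assumes n: "n \<ge> 2" and x: "near_X n (2 * n - 2) x" and y: "y $ 0 = 0" "y $ 1 = 1"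
  shows "odd_part (nottingham_comm x y) $ (2 * n) =
      y $ 2 * (odd_part x $ (2 * n - 1) + of_nat (n - 1) * odd_part x $ (2 * n - 2))
      + y $ 3 * even_part x $ n"
    and "odd_part (nottingham_comm x y) $ (2 * n + 1) = y $ 3 * (even_part x $ n + odd_part x $ n)
      + (y $ 3 + of_nat (n - 1) * y $ 2) * odd_part x $ (2 * n - 1)"
proof -
  define S r c where "S = odd_part x" and "r = odd_part y" and "c = odd_part (nottingham_comm x y)"
  define e where "e = (S oo y) + S"
  have S: "agree (2 * n - 2) S 1"
    using x by (simp add: near_X_def S_def)
  have e_0: "agree (2 * n) e 0"
    using compose_agree_near_1[OF S y] by (simp add: e_def agree_add_eq_0_iff)
  have e_nth: "e $ (2 * n) = y $ 2 * (S $ (2 * n - 1) + of_nat (n - 1) * S $ (2 * n - 2))"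
    "e $ Suc (2 * n) = (y $ 3 + of_nat (n - 1) * y $ 2) * S $ (2 * n - 1)"
    using compose_near_1_nth[OF n S y] by (simp_all add: e_def add_ac)
  have c_0: "agree (2 * n) (c + 1) 0"
    using odd_part_nottingham_comm_agree_1[OF x y] by (simp add: c_def agree_add_eq_0_iff)
  have comm: "agree (2 * n + 2) (r * (c + 1)) (r * e + fps_const (y $ 3) * (x + fps_X))"
    using odd_part_nottingham_comm_agree[OF assms] by (simp only: S_def r_def c_def e_def)
  have lead: "(r * u) $ (2 * n) = u $ (2 * n)"
    "(r * u) $ Suc (2 * n) = u $ Suc (2 * n) + y $ 3 * u $ (2 * n)"
    if "agree (2 * n) u 0" for u
    using mult_nth_lead[OF that, of r] y by (simp_all add: r_def odd_part_nth)
  have x_nth: "(x + fps_X) $ (2 * n) = even_part x $ n" "(x + fps_X) $ Suc (2 * n) = S $ n"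
    using n by (simp_all add: S_def even_part_nth odd_part_nth)
  show c_2n: "c $ (2 * n) =
      y $ 2 * (S $ (2 * n - 1) + of_nat (n - 1) * S $ (2 * n - 2)) + y $ 3 * even_part x $ n"
    using agreeD[OF comm, of "2 * n"] x_nth n by (simp add: lead[OF c_0] lead[OF e_0] e_nth)
  have "c $ Suc (2 * n) + y $ 3 * c $ (2 * n) =
    e $ Suc (2 * n) + y $ 3 * e $ (2 * n) + y $ 3 * S $ n"
    using agreeD[OF comm, of "Suc (2 * n)"] x_nth n by (simp add: lead[OF c_0] lead[OF e_0])
  then have "c $ Suc (2 * n) = y $ 3 * c $ (2 * n) +
    (e $ Suc (2 * n) + y $ 3 * e $ (2 * n) + y $ 3 * S $ n)"
    by (metis add.commute bit_add_self_left)
  then show "c $ (2 * n + 1) = y $ 3 * (even_part x $ n + S $ n)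
      + (y $ 3 + of_nat (n - 1) * y $ 2) * S $ (2 * n - 1)"
    unfolding c_2n e_nth by (simp add: algebra_simps)
qed

lemma even_part_nottingham_comm_agree:
  fixes x y :: "bit fps"
  assumes x: "near_X n (2 * n - 2) x" and y: "y $ 0 = 0" "y $ 1 = 1"
  shows "agree (2 * n) (even_part (nottingham_comm x y) oo (x oo y))
    ((even_part x oo y) + odd_part y * even_part x + even_part y * (odd_part x + 1))"
proof -
  define S P r q where "S = odd_part x" and "P = even_part x" and "r = odd_part y"
    and "q = even_part y"
  define C where "C = odd_part (nottingham_comm x y) oo (x oo y)"
  have x01: "x $ 0 = 0" "x $ 1 = 1" and S: "agree (2 * n - 2) S 1"
    using x by (simp_all add: near_X_def S_def)
  have xX: "agree (2 * n) x fps_X"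
    by (rule near_X_agree_X[OF x]) auto
  have "agree (2 * n) (u oo x) u" for u
    using agree_compose[OF agree_refl xX, of u] by simp
  moreover have "agree (2 * n) C 1"
    using agree_compose[OF odd_part_nottingham_comm_agree_1[OF x y] agree_refl] by (simp add: C_def)
  ultimately have "agree (2 * n) (((P oo y) + q * (S oo y)) * C + ((q oo x) + P * (r oo x)))
      (((P oo y) + q * S) * 1 + (q + P * r))"
    by (intro agree_add agree_mult agree_refl compose_agree_near_1[OF S y])
  moreover have "((P oo y) + q * S) * 1 + (q + P * r) = (P oo y) + r * P + q * (S + 1)"
    by (simp add: algebra_simps)
  moreover have "even_part (nottingham_comm x y) oo (x oo y) =
    ((P oo y) + q * (S oo y)) * C + ((q oo x) + P * (r oo x))"
    using even_part_nottingham_comm[OF x01 y] unfolding bit_fps_add_eq_iff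
    by (simp only: S_def P_def r_def q_def C_def)
  ultimately show ?thesis
    by (simp only: S_def P_def r_def q_def)
qed

lemma
  fixes x y :: "bit fps"
  assumes n: "n \<ge> 2" and x: "near_X n (2 * n - 2) x" and y: "y $ 0 = 0" "y $ 1 = 1"
  shows even_part_nottingham_comm_agree_0: "agree (n + 1) (even_part (nottingham_comm x y)) 0"
    and even_part_nottingham_comm_nth: "even_part (nottingham_comm x y) $ Suc n =
      (y $ 3 + of_nat n * y $ 2) * even_part x $ n + (if n = 2 then y $ 2 * odd_part x $ 2 else 0)"
proof -
  define S P r q where "S = odd_part x" and "P = even_part x" and "r = odd_part y"
    and "q = even_part y"
  define c g F where "c = even_part (nottingham_comm x y)" and "g = x oo y"
    and "F = (P oo y) + r * P + q * (S + 1)"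
  have S: "agree (2 * n - 2) (S + 1) 0" and P: "agree n P 0"
    using x by (simp_all add: near_X_def S_def P_def agree_add_eq_0_iff)
  have g: "g $ 0 = 0" "g $ 1 = 1"
    using x y by (simp_all add: near_X_def g_def compose_nth_1)
  have r: "r $ 0 = 1" "r $ 1 = y $ 3" and q: "q $ 0 = 0" "q $ 1 = y $ 2"
    using y by (simp_all add: r_def q_def odd_part_nth even_part_nth)
  have cg: "agree (2 * n) (c oo g) F"
    using even_part_nottingham_comm_agree[OF x y]
    by (simp add: S_def P_def r_def q_def c_def g_def F_def)
  have "agree (1 + (2 * n - 2)) (q * (S + 1)) 0"
    using q by (intro agree_0_mult S) (simp add: agree_def)
  then have qS: "agree (2 * n - 1) (q * (S + 1)) 0"
    by (rule agree_mono) (use n in simp)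
  note Py = agree_0_compose[OF P, of y]
  have rP: "agree n (r * P) 0"
    using agree_mult[OF agree_refl P, of r] by simp
  have "agree n F 0"
    using agree_add[OF agree_add[OF Py rP] agree_mono[OF qS, of n]] n by (simp add: F_def)
  moreover have "F $ n = 0"
    using compose_nth_lead(1)[OF P y] mult_nth_lead(1)[OF P, of r] agreeD[OF qS, of n] n r
    by (simp add: F_def)
  ultimately have F_0: "agree (n + 1) F (0 oo g)"
    by (simp add: agree_Suc)
  have "agree (n + 1) (c oo g) F"
    by (rule agree_mono[OF cg]) (use n in simp)
  from agree_trans[OF this F_0] show c_0: "agree (n + 1) c 0"
    by (rule agree_compose_cancel) (use g in simp_all)
  have "(q * (S + 1)) $ Suc n = (if n = 2 then y $ 2 * S $ 2 else 0)"
    using mult_nth_lead(2)[OF S, of q] agreeD[OF qS, of "Suc n"] n q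
    by (cases "n = 2") (simp_all add: eval_nat_numeral)
  moreover have "(P oo y) $ Suc n + (r * P) $ Suc n = (y $ 3 + of_nat n * y $ 2) * P $ n"
    using compose_nth_lead(2)[OF P y] mult_nth_lead(2)[OF P, of r] r by (simp add: algebra_simps)
  moreover have "c $ Suc n = (c oo g) $ Suc n"
    using compose_nth_lead(1)[OF c_0 g] by simp
  ultimately show "c $ Suc n = (y $ 3 + of_nat n * y $ 2) * P $ n +
    (if n = 2 then y $ 2 * S $ 2 else 0)"
    using agreeD[OF cg, of "Suc n"] n by (simp add: F_def)
qed

lemma
  fixes x :: "bit fps"
  defines "y \<equiv> fps_X + fps_X ^ 3"
  defines "c \<equiv> nottingham_comm x y"
  assumes x: "x $ 0 = 0" "x $ 1 = 1"
  shows odd_part_comm_X_cube: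
      "(1 + fps_X) * ((odd_part x oo y) * (odd_part c oo (x oo y))) = odd_part x * (1 + x)"
    and even_part_comm_X_cube:
      "even_part c oo (x oo y) = (even_part x oo y) * (odd_part c oo (x oo y)) +
        even_part x * (1 + x)"
proof -
  have y: "y $ 0 = 0" "y $ 1 = 1" "even_part y = 0" "odd_part y = 1 + fps_X"
    by (simp_all add: y_def X_plus_X_cube_eq)
  have "(1 + fps_X) oo x = 1 + x"
    using x by (simp add: fps_compose_add_distrib)
  then show "(1 + fps_X) * ((odd_part x oo y) * (odd_part c oo (x oo y))) = odd_part x * (1 + x)"
    and "even_part c oo (x oo y) = (even_part x oo y) * (odd_part c oo (x oo y)) +
      even_part x * (1 + x)"
    using odd_part_nottingham_comm[OF x y(1,2)] even_part_nottingham_comm[OF x y(1,2)]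
    by (simp_all add: c_def y mult.assoc bit_fps_add_eq_iff)
qed

lemma
  fixes x :: "bit fps"
  defines "y \<equiv> fps_X + fps_X\<^sup>2"
  defines "c \<equiv> nottingham_comm x y"
  assumes x: "x $ 0 = 0" "x $ 1 = 1"
  shows odd_part_comm_X_square: "(odd_part x oo y) * (odd_part c oo (x oo y)) = odd_part x"
    and even_part_comm_X_square: "even_part c oo (x oo y) =
      (even_part x oo y) * (odd_part c oo (x oo y)) + fps_X * odd_part x + (x + even_part x)"
proof -
  have y: "y $ 0 = 0" "y $ 1 = 1" "even_part y = fps_X" "odd_part y = 1"
    by (simp_all add: y_def X_plus_X_square_eq)
  show odd_c: "(odd_part x oo y) * (odd_part c oo (x oo y)) = odd_part x"
    using odd_part_nottingham_comm[OF x y(1,2)] by (simp add: c_def y)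
  have "(even_part c oo (x oo y))
        + ((even_part x oo y) + fps_X * (odd_part x oo y)) * (odd_part c oo (x oo y))
      = x + even_part x"
    using even_part_nottingham_comm[OF x y(1,2)] x by (simp add: c_def y)
  then show "even_part c oo (x oo y) =
      (even_part x oo y) * (odd_part c oo (x oo y)) + fps_X * odd_part x + (x + even_part x)"
    by (simp add: distrib_right mult.assoc odd_c bit_fps_add_eq_iff)
qed

lemma
  fixes k :: nat
  defines "c \<equiv> nottingham_comm (of_parts (fps_X ^ k) 1) (fps_X + fps_X ^ 3)"
  assumes k: "k > 0"
  shows odd_part_comm_even_power: "agree (2 * k) (odd_part c) 1"
    and even_part_comm_even_power: "agree (k + 2) (even_part c) (fps_X ^ (k + 1))"
proof -
  define P x y where "P = (fps_X ^ k :: bit fps)" and "x = of_parts P 1"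
    and "y = (fps_X + fps_X ^ 3 :: bit fps)"
  define g C where "g = x oo y" and "C = odd_part c oo g"
  have x: "x $ 0 = 0" "x $ 1 = 1" and y: "y $ 0 = 0" "y $ 1 = 1" "y $ 2 = 0"
    using k by (simp_all add: x_def y_def P_def)
  then have g: "g $ 0 = 0" "g $ 1 = 1"
    by (simp_all add: g_def compose_nth_1)
  have odd_eq: "(1 + fps_X) * C = 1 + x"
    and even_eq: "even_part c oo g = (P oo y) * C + P * (1 + x)"
    using odd_part_comm_X_cube[OF x] even_part_comm_X_cube[OF x]
    by (simp_all add: C_def c_def g_def y_def) (simp_all add: x_def P_def)
  have "near_X k k x"
    using x by (simp add: near_X_def x_def P_def agree_def)
  then have xX: "agree (2 * k) x fps_X"
    by (rule near_X_agree_X) simp_all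
  have "agree (2 * k) ((1 + fps_X) * C) ((1 + fps_X) * 1)"
    using agree_add[OF agree_refl xX, of 1] by (simp add: odd_eq)
  then have C: "agree (2 * k) C 1"
    by (rule agree_mult_cancel) simp
  then have "agree (2 * k) (odd_part c oo g) (1 oo g)"
    by (simp add: C_def)
  then show "agree (2 * k) (odd_part c) 1"
    by (rule agree_compose_cancel) (use g in simp_all)
  have P: "agree k P 0"
    by (simp add: P_def agree_def)
  have "agree (k + 2 * k) ((P oo y) * (C + 1)) 0" "agree (k + 2 * k) (P * (x + fps_X)) 0"
    using C xX by (intro agree_0_mult agree_0_compose P, simp add: agree_add_eq_0_iff)+
  then have small: "agree (k + 2) ((P oo y) * (C + 1)) 0" "agree (k + 2) (P * (x + fps_X)) 0"
    using agree_mono[of "k + 2 * k" _ 0 "k + 2"] k by simp_all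
  have Py: "agree (k + 2) (P oo y) P"
    using agree_0_compose[OF P, of y] compose_nth_lead[OF P y(1,2)] y(3) P
    by (simp add: agree_Suc) (simp add: agree_def)
  have "even_part c oo g = (P oo y) * (C + 1) + P * (x + fps_X) + ((P oo y) + P) + fps_X * P"
    by (simp add: even_eq algebra_simps)
  also have "agree (k + 2) \<dots> (0 + 0 + (P + P) + fps_X * P)"
    by (intro agree_add agree_refl small Py)
  finally show "agree (k + 2) (even_part c) (fps_X ^ (k + 1))"
    using agree_compose_X_power_cancel[of "k + 1" "even_part c" g 0] g by (simp add: P_def)
qed

lemma
  fixes a :: nat
  defines "c \<equiv> nottingham_comm (of_parts 0 (1 + fps_X ^ a)) (fps_X + fps_X ^ 3)"
  assumes a: "odd a" "a \<ge> 3"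
  shows even_part_comm_odd_power: "even_part c = 0"
    and odd_part_comm_odd_power: "agree (a + 3) (odd_part c) (1 + fps_X ^ (a + 2))"
proof -
  define S x y where "S = (1 + fps_X ^ a :: bit fps)" and "x = of_parts 0 S"
    and "y = (fps_X + fps_X ^ 3 :: bit fps)"
  define g where "g = x oo y"
  have S0: "S $ 0 = 1"
    using a by (simp add: S_def)
  have x: "x $ 0 = 0" "x $ 1 = 1" and y: "y $ 0 = 0" "y $ 1 = 1"
    using S0 by (simp_all add: x_def y_def)
  then have g: "g $ 0 = 0" "g $ 1 = 1"
    by (simp_all add: g_def compose_nth_1)
  have odd_eq: "(1 + fps_X) * ((S oo y) * (odd_part c oo g)) = (1 + x) * S"
    and even_eq: "even_part c oo g = 0 oo g"
    using odd_part_comm_X_cube[OF x] even_part_comm_X_cube[OF x]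
    by (simp_all add: c_def g_def y_def mult.commute[of S]) (simp_all add: x_def S_def)
  then show "even_part c = 0"
    using fps_compose_inj_right[of g "even_part c" 0] g by simp
  have "near_X a a x"
    using x by (simp add: near_X_def x_def S_def agree_def)
  then have "agree (a + 3) x fps_X"
    by (rule near_X_agree_X) (use a in simp_all)
  then have "agree (a + 3) ((1 + fps_X) * ((S oo y) * (odd_part c oo g))) ((1 + fps_X) * S)"
    unfolding odd_eq by (intro agree_mult agree_add agree_refl)
  then have "agree (a + 3) ((S oo y) * (odd_part c oo g)) S"
    by (rule agree_mult_cancel) simp
  moreover have "agree (a + 3) (S oo y) (S + fps_X ^ (a + 2))"
    using one_plus_X_power_compose_X_plus_X_power[OF a(1), of 2]
    by (simp add: S_def y_def eval_nat_numeral)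
  ultimately have "agree (Suc (a + 2)) (odd_part c oo g) (1 + fps_X ^ (a + 2))"
    by (intro agree_quotient_one_plus_X_power[where S = S and S' = "S oo y"] S0)
      (simp_all add: numeral_3_eq_3)
  then show "agree (a + 3) (odd_part c) (1 + fps_X ^ (a + 2))"
    using agree_compose_X_power_cancel[of "a + 2" "odd_part c" g 1] g
    by (simp add: eval_nat_numeral)
qed

lemma
  fixes r :: nat
  defines "c \<equiv> nottingham_comm (of_parts (fps_X ^ r) (1 + fps_X ^ r)) (fps_X + fps_X\<^sup>2)"
  assumes r: "odd r" "r \<ge> 3"
  shows even_part_comm_both_powers: "agree (r + 2) (even_part c) 0"
    and odd_part_comm_both_powers: "agree (r + 2) (odd_part c) (1 + fps_X ^ (r + 1))"
proof -
  define P S where "P = (fps_X ^ r :: bit fps)" and "S = 1 + P"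
  define x y where "x = of_parts P S" and "y = (fps_X + fps_X\<^sup>2 :: bit fps)"
  define g C where "g = x oo y" and "C = odd_part c oo g"
  have S0: "S $ 0 = 1"
    using r by (simp add: S_def P_def)
  have x: "x $ 0 = 0" "x $ 1 = 1" and y: "y $ 0 = 0" "y $ 1 = 1"
    using S0 r by (simp_all add: x_def y_def P_def)
  then have g: "g $ 0 = 0" "g $ 1 = 1"
    by (simp_all add: g_def compose_nth_1)
  have odd_eq: "(S oo y) * C = S"
    and even_eq: "even_part c oo g = (P oo y) * C + fps_X * S + (x + P)"
    using odd_part_comm_X_square[OF x] even_part_comm_X_square[OF x]
    by (simp_all add: C_def c_def g_def y_def) (simp_all add: x_def S_def P_def)
  have Py: "agree (r + 2) (P oo y) (P + fps_X ^ (r + 1))"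
    using X_power_compose_X_plus_X_power[OF r(1), of 1] by (simp add: P_def y_def numeral_2_eq_2)
  have "agree (r + 2) (S oo y) (S + fps_X ^ (r + 1))"
    using one_plus_X_power_compose_X_plus_X_power[OF r(1), of 1]
    by (simp add: S_def P_def y_def numeral_2_eq_2)
  then have C: "agree (Suc (r + 1)) C (1 + fps_X ^ (r + 1))"
    using odd_eq
    by (intro agree_quotient_one_plus_X_power[where S = S and S' = "S oo y"] S0) simp_all
  then show "agree (r + 2) (odd_part c) (1 + fps_X ^ (r + 1))"
    using agree_compose_X_power_cancel[of "r + 1" "odd_part c" g 1] g by (simp add: C_def)
  have "near_X r r x"
    using x by (simp add: near_X_def x_def S_def P_def agree_def)
  then have xX: "agree (r + 2) x fps_X"
    by (rule near_X_agree_X) (use r in simp_all)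
  have "agree 2 C 1"
    using agree_mono[OF C, of 2] r by (simp add: agree_def)
  then have "agree (r + 2) ((P oo y) * (C + 1)) 0"
    by (intro agree_0_mult agree_0_compose) (simp_all add: P_def agree_def agree_add_eq_0_iff)
  moreover have "even_part c oo g = (P oo y) * (C + 1) + ((P oo y) + P) + fps_X * S + x"
    by (simp add: even_eq algebra_simps)
  ultimately have "agree (r + 2) (even_part c oo g)
      (0 + (P + fps_X ^ (r + 1) + P) + fps_X * S + fps_X)"
    using Py xX by (simp only:) (intro agree_add agree_refl; assumption)
  also have "0 + (P + fps_X ^ (r + 1) + P) + fps_X * S + fps_X = (0 oo g)"
    by (simp add: S_def P_def algebra_simps)
  finally show "agree (r + 2) (even_part c) 0"
    by (rule agree_compose_cancel) (use g in simp_all)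
qed

section \<open>Coefficient conditions for the lower central series\<close>

text \<open>The case \<open>n = 2\<close> is exceptional because there the coefficient of \<open>t\<^bsup>2n+1\<^esup>\<close>, that is
  \<open>odd_part f $ n\<close>, need not vanish and contributes to the commutators.\<close>
definition nottingham_lcs :: "nat \<Rightarrow> bit fps set" where
  "nottingham_lcs n = {f. near_X n (2 * n - 2) f \<and>
     (n \<ge> 2 \<longrightarrow> (if odd n then odd_part f $ (2 * n - 1) = even_part f $ n
       else odd_part f $ (2 * n - 2) = even_part f $ n \<and>
            odd_part f $ (2 * n - 1) = (if n = 2 then even_part f $ n else 0)))}"

definition riordan_lcs :: "nat \<Rightarrow> rpair set" where
  "riordan_lcs n = {(g, f). g $ 0 = 1 \<and> agree (2 * n - 2) g 1 \<and> f \<in> nottingham_lcs n}"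

lemma riordan_lcs_iff:
  "(g, f) \<in> riordan_lcs n \<longleftrightarrow> g $ 0 = 1 \<and> agree (2 * n - 2) g 1 \<and> f \<in> nottingham_lcs n"
  by (simp add: riordan_lcs_def)

lemma nottingham_lcs_near_X: "f \<in> nottingham_lcs n \<Longrightarrow> near_X n (2 * n - 2) f"
  by (simp add: nottingham_lcs_def)

lemma nottingham_lcs_nth_0_1:
  assumes "f \<in> nottingham_lcs n"
  shows "f $ 0 = 0" "f $ 1 = 1"
  using nottingham_lcs_near_X[OF assms] by (simp_all add: near_X_def)

lemma nottingham_lcs_agree_X: "f \<in> nottingham_lcs n \<Longrightarrow> agree (2 * n) f fps_X"
  by (rule near_X_agree_X[OF nottingham_lcs_near_X]) auto

lemma nottingham_lcs_1: "f \<in> nottingham_lcs 1 \<longleftrightarrow> f $ 0 = 0 \<and> f $ 1 = 1"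
  by (auto simp: nottingham_lcs_def near_X_def agree_def even_part_nth)

lemma fps_X_in_nottingham_lcs [simp]: "fps_X \<in> nottingham_lcs n"
  by (auto simp: nottingham_lcs_def)

lemma riordan_lcs_1: "riordan_lcs 1 = riordan_carrier"
  unfolding riordan_lcs_def riordan_carrier_def nottingham_lcs_1 by (simp add: agree_def)

lemma riordan_lcs_subset: "riordan_lcs n \<subseteq> riordan_carrier"
  using nottingham_lcs_nth_0_1 by (auto simp: riordan_lcs_def)

lemma nottingham_lcs_cong:
  assumes f: "f \<in> nottingham_lcs n" and agree: "agree (4 * n + 2) f h"
  shows "h \<in> nottingham_lcs n"
proof -
  have parts: "agree (2 * n + 1) (even_part f) (even_part h)"
    "agree (2 * n + 1) (odd_part f) (odd_part h)"
    using agree by (intro agree_even_part agree_odd_part; simp)+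
  then have "even_part h $ k = even_part f $ k" "odd_part h $ k = odd_part f $ k"
    if "k \<le> 2 * n" for k
    using that by (simp_all add: agree_def)
  moreover have "h $ 0 = f $ 0" "h $ 1 = f $ 1"
    using agree by (simp_all add: agree_def)
  ultimately show ?thesis
    using f by (auto simp: nottingham_lcs_def near_X_def agree_def)
qed

lemma rclosure_riordan_lcs: "rclosure (riordan_lcs n) = riordan_lcs n"
proof (rule rclosure_eqI[OF riordan_lcs_subset])
  fix x assume x: "x \<in> riordan_carrier"
    and "\<And>N. \<exists>h\<in>riordan_lcs n. agree N (fst h) (fst x) \<and> agree N (snd h) (snd x)"
  then obtain h where h: "h \<in> riordan_lcs n" "agree (4 * n + 2) (fst h) (fst x)"
    "agree (4 * n + 2) (snd h) (snd x)"
    by blast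
  have "snd x \<in> nottingham_lcs n"
    using h(1) by (intro nottingham_lcs_cong[OF _ h(3)]) (auto simp: riordan_lcs_def)
  moreover have "agree (2 * n - 2) (fst x) 1"
    using h(1) agree_trans[OF agree_sym[OF agree_mono[OF h(2), of "2 * n - 2"]]]
    by (auto simp: riordan_lcs_def)
  ultimately show "x \<in> riordan_lcs n"
    using x by (cases x) (simp add: riordan_lcs_iff)
qed

lemma nottingham_lcs_Suc_even:
  assumes "n \<ge> 2" "even n"
  shows "f \<in> nottingham_lcs (Suc n) \<longleftrightarrow> f \<in> nottingham_lcs n \<and> even_part f $ n = 0 \<and>
    odd_part f $ (2 * n + 1) + even_part f $ (n + 1) = 0"
  using assms
  by (auto simp: nottingham_lcs_def near_X_def agree_1_double_iff agree_Suc bit_add_eq_0_iff)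

lemma nottingham_lcs_Suc_odd:
  assumes "n \<ge> 2" "odd n"
  shows "f \<in> nottingham_lcs (Suc n) \<longleftrightarrow> f \<in> nottingham_lcs n \<and>
    even_part f $ n = 0 \<and> odd_part f $ (2 * n - 2) = 0 \<and>
    odd_part f $ (2 * n) + even_part f $ (n + 1) = 0 \<and> odd_part f $ (2 * n + 1) = 0"
  using assms
  by (auto simp: nottingham_lcs_def near_X_def agree_1_double_iff agree_Suc bit_add_eq_0_iff)

lemma nottingham_lcs_2:
  "f \<in> nottingham_lcs 2 \<longleftrightarrow> f $ 0 = 0 \<and> f $ 1 = 1 \<and> even_part f $ 1 = 0 \<and> odd_part f $ 1 = 0 \<and>
    odd_part f $ 2 = even_part f $ 2 \<and> odd_part f $ 3 = even_part f $ 2"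
  by (auto simp: nottingham_lcs_def near_X_def agree_def less_2_cases_iff even_part_nth
    odd_part_nth)

lemma
  assumes n: "n \<ge> 2" and f: "f \<in> nottingham_lcs n" and h: "h \<in> nottingham_lcs n"
  shows odd_part_compose_agree: "agree (2 * n + 2) (odd_part (f oo h)) (odd_part f * odd_part h)"
    and even_part_compose_agree: "agree (n + 2) (even_part (f oo h)) (even_part f + even_part h)"
proof -
  let ?P = "even_part f oo h" and ?S = "odd_part f oo h"
  have hX: "agree (2 * n) h fps_X"
    by (rule nottingham_lcs_agree_X[OF h])
  have h_nth: "h $ 0 = 0" "h $ 1 = 1" "h $ 2 = 0" "h $ 3 = 0"
    using nottingham_lcs_nth_0_1[OF h] agreeD[OF hX, of 2] agreeD[OF hX, of 3] n by simp_all
  have odd_f: "agree (2 * n - 2) (odd_part f) 1" and even_h: "agree n (even_part h) 0"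
    using nottingham_lcs_near_X[OF f] nottingham_lcs_near_X[OF h] by (simp_all add: near_X_def)
  have "?S $ (2 * n) = odd_part f $ (2 * n)" "?S $ Suc (2 * n) = odd_part f $ Suc (2 * n)"
    using compose_near_1_nth[OF n odd_f h_nth(1,2)] h_nth(3,4) by simp_all
  with compose_agree_near_1[OF odd_f h_nth(1,2)] have S: "agree (2 * n + 2) ?S (odd_part f)"
    by (simp add: agree_Suc)
  from agree_mult[OF agree_refl[of _ "odd_part h"] S]
  show "agree (2 * n + 2) (odd_part (f oo h)) (odd_part f * odd_part h)"
    by (simp add: odd_part_compose h_nth(1) mult.commute)
  have "agree (2 * n - 2) ?S 1"
    using agree_trans[OF agree_mono[OF S] odd_f] by simp
  then have "agree (2 * n - 2 + n) (?S * even_part h) (even_part h)"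
    using even_h by (rule agree_mult_unit)
  then have "agree (n + 2) (even_part h * ?S) (even_part h)"
    by (subst mult.commute, elim agree_mono) (use n in simp)
  moreover have "agree (2 * n) ?P (even_part f)"
    using agree_compose[OF agree_refl hX, of "even_part f"] by simp
  then have "agree (n + 2) ?P (even_part f)"
    by (rule agree_mono) (use n in simp)
  ultimately show "agree (n + 2) (even_part (f oo h)) (even_part f + even_part h)"
    by (simp add: even_part_compose h_nth(1) agree_add)
qed

lemma
  assumes n: "n \<ge> 2" and f: "f \<in> nottingham_lcs n" and h: "h \<in> nottingham_lcs n"
  shows even_part_compose_nth: "k \<le> n + 1 \<Longrightarrow>
      even_part (f oo h) $ k = even_part f $ k + even_part h $ k"
    and odd_part_compose_nth: "n > 2 \<Longrightarrow> 0 < k \<Longrightarrow> k \<le> 2 * n + 1 \<Longrightarrow>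
      odd_part (f oo h) $ k = odd_part f $ k + odd_part h $ k"
    and odd_part_compose_nth_last: "odd_part (f oo h) $ (2 * n + 1) =
      odd_part f $ (2 * n + 1) + odd_part h $ (2 * n + 1)"
proof -
  have odd_fh: "agree (2 * n + 2) (odd_part (f oo h)) (odd_part f * odd_part h)"
    by (rule odd_part_compose_agree[OF n f h])
  show "even_part (f oo h) $ k = even_part f $ k + even_part h $ k" if "k \<le> n + 1"
    using agreeD[OF even_part_compose_agree[OF n f h], of k] that by simp
  have "agree (2 * (2 * n - 2)) (odd_part f * odd_part h) (odd_part f + odd_part h + 1)"
    using nottingham_lcs_near_X[OF f] nottingham_lcs_near_X[OF h]
    by (intro agree_mult_near_1) (simp_all add: near_X_def)
  then show odd_nth: "odd_part (f oo h) $ k = odd_part f $ k + odd_part h $ k"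
    if "n > 2" "0 < k" "k \<le> 2 * n + 1" for k
    using agreeD[OF odd_fh, of k] that by (simp add: agree_def)
  show "odd_part (f oo h) $ (2 * n + 1) = odd_part f $ (2 * n + 1) + odd_part h $ (2 * n + 1)"
  proof (cases "n = 2")
    case True
    have S_nth: "odd_part u $ 0 = 1" "odd_part u $ 1 = 0" "odd_part u $ 3 = odd_part u $ 2"
      if "u \<in> nottingham_lcs 2" for u
      using that by (simp_all add: nottingham_lcs_2 odd_part_nth[of _ 0])
    have "{0..5::nat} = {0,1,2,3,4,5}" by auto
    then have "(odd_part f * odd_part h) $ 5 = odd_part f $ 5 + odd_part h $ 5"
      using S_nth[of f] S_nth[of h] f h True by (simp add: fps_mult_nth add_ac mult_ac)
    then show ?thesis
      using agreeD[OF odd_fh, of 5] True by simp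
  qed (use n in \<open>simp add: odd_nth\<close>)
qed

section \<open>The quotients of successive terms\<close>

abbreviation (input) Z2_cubed_Z4 :: "(int \<times> int \<times> int \<times> int) monoid" where
  "Z2_cubed_Z4 \<equiv> Zmod 2 \<times>\<times> Zmod 2 \<times>\<times> Zmod 2 \<times>\<times> Zmod 4"

abbreviation (input) Z2_pow_4 :: "(int \<times> int \<times> int \<times> int) monoid" where
  "Z2_pow_4 \<equiv> Zmod 2 \<times>\<times> Zmod 2 \<times>\<times> Zmod 2 \<times>\<times> Zmod 2"

abbreviation (input) Z2_pow_6 :: "(int \<times> int \<times> int \<times> int \<times> int \<times> int) monoid" where
  "Z2_pow_6 \<equiv> Zmod 2 \<times>\<times> Zmod 2 \<times>\<times> Zmod 2 \<times>\<times> Zmod 2 \<times>\<times> Zmod 2 \<times>\<times> Zmod 2"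

text \<open>The last component is a homomorphism to \<open>\<int>/4\<close> because the high bit
  \<open>P\<^sub>2 + S\<^sub>2 + P\<^sub>1 S\<^sub>1\<close> satisfies exactly the carry rule for the low bit \<open>P\<^sub>1 + S\<^sub>1\<close>.\<close>
definition ab_map :: "rpair \<Rightarrow> int \<times> int \<times> int \<times> int" where
  "ab_map x = (let P = even_part (snd x); S = odd_part (snd x) in
     (of_bit (fst x $ 1), of_bit (S $ 1), of_bit (S $ 2 + S $ 3 + S $ 1 * S $ 2),
      of_bit (P $ 1 + S $ 1) + 2 * of_bit (P $ 2 + S $ 2 + P $ 1 * S $ 1)))"

definition lcs_map_even :: "nat \<Rightarrow> rpair \<Rightarrow> int \<times> int \<times> int \<times> int" where
  "lcs_map_even n x = (of_bit (fst x $ (2 * n - 2)), of_bit (fst x $ (2 * n - 1)),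
     of_bit (even_part (snd x) $ n),
     of_bit (odd_part (snd x) $ (2 * n + 1) + even_part (snd x) $ (n + 1)))"

definition lcs_map_odd :: "nat \<Rightarrow> rpair \<Rightarrow> int \<times> int \<times> int \<times> int \<times> int \<times> int" where
  "lcs_map_odd n x = (of_bit (fst x $ (2 * n - 2)), of_bit (fst x $ (2 * n - 1)),
     of_bit (even_part (snd x) $ n), of_bit (odd_part (snd x) $ (2 * n - 2)),
     of_bit (odd_part (snd x) $ (2 * n) + even_part (snd x) $ (n + 1)),
     of_bit (odd_part (snd x) $ (2 * n + 1)))"

lemma fst_mult_riordan_lcs_nth:
  assumes x: "x \<in> riordan_lcs n" and y: "y \<in> riordan_lcs n" and k: "0 < k" "k < 2 * n"
    and n: "n \<ge> 2"
  shows "fst (x \<otimes>\<^bsub>Riordan\<^esub> y) $ k = fst x $ k + fst y $ k"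
proof -
  obtain g1 f1 g2 f2 where xy: "x = (g1, f1)" "y = (g2, f2)" by fastforce
  have g: "agree (2 * n - 2) g1 1" "agree (2 * n - 2) g2 1" and f1: "f1 \<in> nottingham_lcs n"
    using x y by (simp_all add: xy riordan_lcs_iff)
  have "agree (2 * n) (g2 oo f1) g2"
    by (rule compose_agree_near_1[OF g(2) nottingham_lcs_nth_0_1[OF f1]])
  then have "agree (2 * n) (g1 * (g2 oo f1)) (g1 * g2)"
    by (intro agree_mult agree_refl)
  moreover have "agree (2 * (2 * n - 2)) (g1 * g2) (g1 + g2 + 1)"
    using g by (rule agree_mult_near_1)
  ultimately show ?thesis
    using k n by (auto simp: xy agree_def)
qed

lemma
  assumes x: "x \<in> riordan_lcs n" and y: "y \<in> riordan_lcs n" and n: "n \<ge> 2"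
  shows even_part_mult_riordan_lcs_nth: "k \<le> n + 1 \<Longrightarrow>
      even_part (snd (x \<otimes>\<^bsub>Riordan\<^esub> y)) $ k = even_part (snd x) $ k + even_part (snd y) $ k"
    and odd_part_mult_riordan_lcs_nth: "n > 2 \<Longrightarrow> 0 < k \<Longrightarrow> k \<le> 2 * n + 1 \<Longrightarrow>
      odd_part (snd (x \<otimes>\<^bsub>Riordan\<^esub> y)) $ k = odd_part (snd x) $ k + odd_part (snd y) $ k"
    and odd_part_mult_riordan_lcs_nth_last:
      "odd_part (snd (x \<otimes>\<^bsub>Riordan\<^esub> y)) $ (2 * n + 1) =
        odd_part (snd x) $ (2 * n + 1) + odd_part (snd y) $ (2 * n + 1)"
  using x y even_part_compose_nth[OF n, of "snd y" "snd x" k]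
    odd_part_compose_nth[OF n, of "snd y" "snd x" k]
    odd_part_compose_nth_last[OF n, of "snd y" "snd x"]
  by (cases x; cases y; simp add: riordan_lcs_iff add.commute)+

lemma lcs_map_even_hom:
  assumes "n \<ge> 2"
  shows "lcs_map_even n \<in> hom (Riordan\<lparr>carrier := riordan_lcs n\<rparr>) Z2_pow_4"
  unfolding lcs_map_even_def[abs_def] hom_paired using assms
  by (intro conjI of_bit_hom)
    (simp_all add: fst_mult_riordan_lcs_nth even_part_mult_riordan_lcs_nth
      odd_part_mult_riordan_lcs_nth_last[unfolded Suc_eq_plus1[symmetric]] add_ac)

lemma lcs_map_odd_hom:
  assumes "n \<ge> 2" "odd n"
  shows "lcs_map_odd n \<in> hom (Riordan\<lparr>carrier := riordan_lcs n\<rparr>) Z2_pow_6"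
proof -
  have "n > 2"
    using assms by (cases "n = 2") auto
  then show ?thesis
    unfolding lcs_map_odd_def[abs_def] hom_paired
    by (intro conjI of_bit_hom)
      (simp_all add: fst_mult_riordan_lcs_nth even_part_mult_riordan_lcs_nth
        odd_part_mult_riordan_lcs_nth add_ac)
qed

lemma kernel_lcs_map_even:
  assumes "n \<ge> 2" "even n"
  shows "kernel (Riordan\<lparr>carrier := riordan_lcs n\<rparr>) Z2_pow_4 (lcs_map_even n) = riordan_lcs (Suc n)"
  using assms
  by (auto simp: kernel_def riordan_lcs_iff lcs_map_even_def nottingham_lcs_Suc_even
      agree_1_double_iff)

lemma kernel_lcs_map_odd:
  assumes "n \<ge> 2" "odd n"
  shows "kernel (Riordan\<lparr>carrier := riordan_lcs n\<rparr>) Z2_pow_6 (lcs_map_odd n) = riordan_lcs (Suc n)"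
  using assms
  by (auto simp: kernel_def riordan_lcs_iff lcs_map_odd_def nottingham_lcs_Suc_odd
      agree_1_double_iff)

lemma parts_compose_low_nth:
  fixes f h :: "bit fps"
  assumes "f $ 0 = 0" "f $ 1 = 1" "h $ 0 = 0" "h $ 1 = 1"
  defines "P \<equiv> even_part h" and "S \<equiv> odd_part h" and "P' \<equiv> even_part f" and "S' \<equiv> odd_part f"
  shows "even_part (f oo h) $ 1 = P $ 1 + P' $ 1"
    and "even_part (f oo h) $ 2 = P $ 2 + P' $ 2 + P' $ 1 * P $ 1 + P $ 1 * S' $ 1"
    and "odd_part (f oo h) $ 1 = S $ 1 + S' $ 1"
    and "odd_part (f oo h) $ 2 = S $ 2 + S' $ 2 + S' $ 1 * P $ 1 + S' $ 1 * S $ 1"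
    and "odd_part (f oo h) $ 3 = S $ 3 + S' $ 3 + S' $ 2 * S $ 1 +
      S' $ 1 * (S $ 1 + S $ 2 + P $ 1 * S $ 1)"
proof -
  have intervals: "{0..1::nat} = {0,1}" "{0..2::nat} = {0,1,2}" "{0..3::nat} = {0,1,2,3}"
    by auto
  have nth_0: "P $ 0 = 0" "S $ 0 = 1" "P' $ 0 = 0" "S' $ 0 = 1"
    using assms(1-4) by (simp_all add: P_def S_def P'_def S'_def even_part_nth odd_part_nth)
  have nth_h: "(u oo h) $ Suc 0 = u $ Suc 0" "(u oo h) $ 2 = u $ 2 + u $ 1 * P $ 1"
    "(u oo h) $ 3 = u $ 3 + u $ 1 * S $ 1" for u
    using compose_nth_2_3[OF assms(3,4), of u] assms(4)
    by (simp_all add: compose_nth_1 P_def S_def even_part_nth odd_part_nth)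
  show "even_part (f oo h) $ 1 = P $ 1 + P' $ 1"
    and "even_part (f oo h) $ 2 = P $ 2 + P' $ 2 + P' $ 1 * P $ 1 + P $ 1 * S' $ 1"
    and "odd_part (f oo h) $ 1 = S $ 1 + S' $ 1"
    and "odd_part (f oo h) $ 2 = S $ 2 + S' $ 2 + S' $ 1 * P $ 1 + S' $ 1 * S $ 1"
    and "odd_part (f oo h) $ 3 = S $ 3 + S' $ 3 + S' $ 2 * S $ 1 +
      S' $ 1 * (S $ 1 + S $ 2 + P $ 1 * S $ 1)"
    unfolding even_part_compose[OF assms(3)] odd_part_compose[OF assms(3)] fps_add_nth fps_mult_nth
      intervals
      P_def[symmetric] S_def[symmetric] P'_def[symmetric] S'_def[symmetric]
    by (simp_all add: nth_0 nth_h algebra_simps)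
qed

lemma ab_map_hom: "ab_map \<in> hom Riordan Z2_cubed_Z4"
proof -
  have "fst (x \<otimes>\<^bsub>Riordan\<^esub> y) $ 1 = fst x $ 1 + fst y $ 1"
    if "x \<in> riordan_carrier" "y \<in> riordan_carrier" for x y
    using that by (cases x; cases y) (simp add: fps_mult_nth compose_nth_1 add.commute)
  moreover have "snd (x \<otimes>\<^bsub>Riordan\<^esub> y) = snd y oo snd x" for x y
    by (cases x; cases y) simp
  moreover have "snd x $ 0 = 0" "snd x $ 1 = 1" if "x \<in> riordan_carrier" for x
    using that by (cases x, simp)+
  ultimately show ?thesis
    unfolding ab_map_def[abs_def] Let_def hom_paired
    by (intro conjI of_bit_hom of_bit_carry_hom)
      (simp_all add: parts_compose_low_nth algebra_simps del: One_nat_def)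
qed

lemma kernel_ab_map: "kernel Riordan Z2_cubed_Z4 ab_map = riordan_lcs 2"
proof -
  have "of_bit a + 2 * of_bit b = (0 :: int) \<longleftrightarrow> a = 0 \<and> b = 0" for a b
    by (cases a; cases b) simp_all
  then have "ab_map (g, f) = (0, 0, 0, 0) \<longleftrightarrow> (g, f) \<in> riordan_lcs 2"
    if "(g, f) \<in> riordan_carrier" for g f
    using that
    by (auto simp: ab_map_def Let_def riordan_lcs_iff nottingham_lcs_2 bit_add_eq_0_iff agree_def
      less_2_cases_iff)
  then show ?thesis
    using riordan_lcs_subset[of 2] by (auto simp: kernel_def)
qed

lemma ab_map_surj: "ab_map ` riordan_carrier = carrier Z2_cubed_Z4"
proof
  show "ab_map ` riordan_carrier \<subseteq> carrier Z2_cubed_Z4"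
    using hom_carrier[OF ab_map_hom] by simp
  show "carrier Z2_cubed_Z4 \<subseteq> ab_map ` riordan_carrier"
  proof
    fix v assume "v \<in> carrier Z2_cubed_Z4"
    then obtain p q r s t where v: "v = (of_bit p, of_bit q, of_bit r, of_bit s + 2 * of_bit t)"
      by (auto simp: carrier_Zmod_2 carrier_Zmod_4)
    define P where "P = fps_const (s + q) * fps_X + fps_const (t + r + (s + q) * q) * fps_X\<^sup>2"
    define S where "S = 1 + fps_const q * fps_X + fps_const r * fps_X\<^sup>2 +
      fps_const (q * r) * fps_X ^ 3"
    have "ab_map (1 + fps_const p * fps_X, of_parts P S) = v"
      by (simp add: ab_map_def Let_def v P_def S_def algebra_simps)
    moreover have "(1 + fps_const p * fps_X, of_parts P S) \<in> riordan_carrier"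
      by (simp add: P_def S_def)
    ultimately show "v \<in> ab_map ` riordan_carrier"
      by (metis image_eqI)
  qed
qed

lemma lcs_map_even_surj:
  assumes "n \<ge> 2" "even n"
  shows "lcs_map_even n ` riordan_lcs n = carrier Z2_pow_4"
proof
  show "lcs_map_even n ` riordan_lcs n \<subseteq> carrier Z2_pow_4"
    using hom_carrier[OF lcs_map_even_hom[OF assms(1)]] by simp
  show "carrier Z2_pow_4 \<subseteq> lcs_map_even n ` riordan_lcs n"
  proof
    fix v assume "v \<in> carrier Z2_pow_4"
    then obtain p q r s where v: "v = (of_bit p, of_bit q, of_bit r, of_bit s)"
      by (auto simp: carrier_Zmod_2)
    define g where "g = 1 + fps_const p * fps_X ^ (2 * n - 2) + fps_const q * fps_X ^ (2 * n - 1)"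
    define f where "f = of_parts (fps_const r * fps_X ^ n)
      (1 + fps_const r * fps_X ^ (2 * n - 2)
        + fps_const (if n = 2 then r else 0) * fps_X ^ (2 * n - 1)
        + fps_const s * fps_X ^ (2 * n + 1))"
    have "f \<in> nottingham_lcs n"
      using assms by (auto simp: nottingham_lcs_def near_X_def f_def agree_def)
    then have "(g, f) \<in> riordan_lcs n"
      using assms by (auto simp: riordan_lcs_iff g_def agree_def)
    moreover have "lcs_map_even n (g, f) = v"
      using assms by (auto simp: lcs_map_even_def f_def g_def v)
    ultimately show "v \<in> lcs_map_even n ` riordan_lcs n"
      by force
  qed
qed

lemma lcs_map_odd_surj:
  assumes "n \<ge> 2" "odd n"
  shows "lcs_map_odd n ` riordan_lcs n = carrier Z2_pow_6"
proof
  show "lcs_map_odd n ` riordan_lcs n \<subseteq> carrier Z2_pow_6"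
    using hom_carrier[OF lcs_map_odd_hom[OF assms]] by simp
  show "carrier Z2_pow_6 \<subseteq> lcs_map_odd n ` riordan_lcs n"
  proof
    fix v assume "v \<in> carrier Z2_pow_6"
    then obtain p q r s t u
      where v: "v = (of_bit p, of_bit q, of_bit r, of_bit s, of_bit t, of_bit u)"
      by (auto simp: carrier_Zmod_2)
    define g where "g = 1 + fps_const p * fps_X ^ (2 * n - 2) + fps_const q * fps_X ^ (2 * n - 1)"
    define f where "f = of_parts (fps_const r * fps_X ^ n)
      (1 + fps_const s * fps_X ^ (2 * n - 2) + fps_const r * fps_X ^ (2 * n - 1)
        + fps_const t * fps_X ^ (2 * n) + fps_const u * fps_X ^ (2 * n + 1))"
    have "f \<in> nottingham_lcs n"
      using assms by (auto simp: nottingham_lcs_def near_X_def f_def agree_def)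
    then have "(g, f) \<in> riordan_lcs n"
      using assms by (auto simp: riordan_lcs_iff g_def agree_def)
    moreover have "lcs_map_odd n (g, f) = v"
      using assms by (auto simp: lcs_map_odd_def f_def g_def v)
    ultimately show "v \<in> lcs_map_odd n ` riordan_lcs n"
      by force
  qed
qed

lemma group_hom_ab_map: "group_hom Riordan Z2_cubed_Z4 ab_map"
  by (intro group_hom.intro group_hom_axioms.intro group_Riordan ab_map_hom DirProd_group
    group_Zmod)

lemma subgroup_riordan_lcs: "n \<ge> 1 \<Longrightarrow> subgroup (riordan_lcs n) Riordan"
proof (induction n rule: nat_induct_at_least)
  case base
  show ?case
    using Riordan.subgroup_self by (simp only: riordan_lcs_1)
next
  case (Suc n)
  consider "n = 1" | "n \<ge> 2" "even n" | "n \<ge> 2" "odd n"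
    using Suc.hyps by linarith
  then show ?case
  proof cases
    case 1
    then show ?thesis
      using group_hom.subgroup_kernel[OF group_hom_ab_map] unfolding kernel_ab_map
      by (simp add: numeral_2_eq_2)
  next
    case 2
    then show ?thesis
      using Riordan.subgroup_kernel_restrict[OF Suc.IH _ lcs_map_even_hom]
      by (simp add: kernel_lcs_map_even DirProd_group)
  next
    case 3
    then show ?thesis
      using Riordan.subgroup_kernel_restrict[OF Suc.IH _ lcs_map_odd_hom]
      by (simp add: kernel_lcs_map_odd DirProd_group)
  qed
qed

lemma riordan_lcs_quotient_1: "Riordan Mod riordan_lcs 2 \<cong> Z2_cubed_Z4"
  using group_hom.FactGroup_iso[OF group_hom_ab_map] ab_map_surj by (simp add: kernel_ab_map)

lemma riordan_lcs_quotient_even: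
  assumes "n \<ge> 2" "even n"
  shows "(Riordan\<lparr>carrier := riordan_lcs n\<rparr>) Mod riordan_lcs (Suc n) \<cong> Z2_pow_4"
  using Riordan.FactGroup_kernel_restrict_iso[OF subgroup_riordan_lcs _ lcs_map_even_hom
    lcs_map_even_surj] assms
  by (simp add: kernel_lcs_map_even DirProd_group)

lemma riordan_lcs_quotient_odd:
  assumes "n \<ge> 2" "odd n"
  shows "(Riordan\<lparr>carrier := riordan_lcs n\<rparr>) Mod riordan_lcs (Suc n) \<cong> Z2_pow_6"
  using Riordan.FactGroup_kernel_restrict_iso[OF subgroup_riordan_lcs _ lcs_map_odd_hom
    lcs_map_odd_surj] assms
  by (simp add: kernel_lcs_map_odd DirProd_group)

section \<open>The lower central series\<close>

lemma nottingham_comm_in_lcs_ge_2: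
  assumes n: "n \<ge> 2" and x: "x \<in> nottingham_lcs n" and y: "y $ 0 = 0" "y $ 1 = 1"
  shows "nottingham_comm x y \<in> nottingham_lcs (Suc n)"
proof -
  let ?c = "nottingham_comm x y"
  note near = nottingham_lcs_near_X[OF x]
  have "?c $ 0 = 0" "?c $ 1 = 1"
    using nottingham_comm_nth_0_1[OF nottingham_lcs_nth_0_1[OF x] y] by simp_all
  moreover have "agree (2 * n) (odd_part ?c) 1" "agree (n + 1) (even_part ?c) 0"
    using odd_part_nottingham_comm_agree_1[OF near y] even_part_nottingham_comm_agree_0[OF n near y]
    by simp_all
  ultimately have near_c: "near_X (Suc n) (2 * n) ?c"
    by (simp add: near_X_def)
  note c_nth = odd_part_nottingham_comm_nth[OF n near y] even_part_nottingham_comm_nth[OF n near y]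
  have odd_n: "odd_part x $ n = 0" if "n \<noteq> 2"
    using agreeD[of "2 * n - 2" "odd_part x" 1 n] near n that by (simp add: near_X_def)
  consider "n = 2" | "n > 2" "even n" | "n > 2" "odd n"
    using n by linarith
  then show ?thesis
  proof cases
    case 1
    then show ?thesis
      using x near_c c_nth unfolding 1 by (auto simp: nottingham_lcs_def bit_of_nat algebra_simps)
  next
    case 2
    then show ?thesis
      using x near_c c_nth odd_n by (auto simp: nottingham_lcs_def bit_of_nat algebra_simps)
  next
    case 3
    then show ?thesis
      using x near_c c_nth odd_n by (auto simp: nottingham_lcs_def bit_of_nat algebra_simps)
  qed
qed

lemma rcomm_in_riordan_lcs_2:
  assumes x: "x \<in> riordan_carrier" and y: "y \<in> riordan_carrier"
  shows "rcomm x y \<in> riordan_lcs 2"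
proof -
  interpret ab: group_hom Riordan Z2_cubed_Z4 ab_map
    rewrites "carrier Riordan = riordan_carrier" and "\<one>\<^bsub>Riordan\<^esub> = (1, fps_X)"
    by (rule group_hom_ab_map) simp_all
  have c: "rcomm x y \<in> riordan_carrier"
    using x y by (rule rcomm_closed)
  have "ab_map (y \<otimes>\<^bsub>Riordan\<^esub> x) \<otimes>\<^bsub>Z2_cubed_Z4\<^esub> ab_map (rcomm x y) = ab_map (x \<otimes>\<^bsub>Riordan\<^esub> y)"
    using x y c rcomm_eq[OF x y] by (simp flip: ab.hom_mult)
  also have "\<dots> = ab_map (y \<otimes>\<^bsub>Riordan\<^esub> x)"
    using x y by (simp add: mult_DirProd' add.commute)
  finally have "ab_map (rcomm x y) = \<one>\<^bsub>Z2_cubed_Z4\<^esub>"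
    using x y c by (metis ab.H.l_cancel_one ab.hom_closed Riordan.m_closed)
  then have "rcomm x y \<in> kernel Riordan Z2_cubed_Z4 ab_map"
    using c by (simp add: kernel_def)
  then show ?thesis
    by (simp only: kernel_ab_map)
qed

lemma fst_rcomm_agree_1:
  assumes x: "(g1, f1) \<in> riordan_lcs n" and y: "(g2, f2) \<in> riordan_carrier"
  shows "agree (2 * n) (fst (rcomm (g1, f1) (g2, f2))) 1"
proof -
  define c where "c = fst (rcomm (g1, f1) (g2, f2))"
  have x_carrier: "(g1, f1) \<in> riordan_carrier"
    using x riordan_lcs_subset by blast
  have f1: "f1 \<in> nottingham_lcs n" and g1: "agree (2 * n - 2) g1 1" "g1 $ 0 = 1"
    using x by (simp_all add: riordan_lcs_iff)
  have y01: "f2 $ 0 = 0" "f2 $ 1 = 1" "g2 $ 0 = 1"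
    using y by simp_all
  have "agree (2 * n) (g1 oo f2) g1"
    by (rule compose_agree_near_1[OF g1(1) y01(1,2)])
  then have "agree (2 * n) (g2 * g1 * (c oo (f1 oo f2))) (g2 * (g1 oo f2) * (c oo (f1 oo f2)))"
    by (intro agree_mult agree_refl) (rule agree_sym)
  also have "g2 * (g1 oo f2) * (c oo (f1 oo f2)) = g1 * (g2 oo f1)"
    using rcomm_components(2)[OF x_carrier y] by (simp only: c_def)
  also have "agree (2 * n) (g1 * (g2 oo f1)) (g1 * (g2 oo fps_X))"
    by (intro agree_mult agree_compose agree_refl nottingham_lcs_agree_X f1)
  also have "g1 * (g2 oo fps_X) = g2 * g1 * (1 oo (f1 oo f2))"
    by (simp add: mult.commute)
  finally have "agree (2 * n) (c oo (f1 oo f2)) (1 oo (f1 oo f2))"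
    by (rule agree_mult_cancel) (use g1 y01 in simp)
  then show ?thesis
    unfolding c_def
    by (rule agree_compose_cancel) (use x_carrier y01 in \<open>simp_all add: compose_nth_1\<close>)
qed

lemma rcomm_in_riordan_lcs:
  assumes n: "n \<ge> 1" and x: "x \<in> riordan_lcs n" and y: "y \<in> riordan_carrier"
  shows "rcomm x y \<in> riordan_lcs (Suc n)"
proof (cases "n = 1")
  case True
  then show ?thesis
    using rcomm_in_riordan_lcs_2[of x y] x y riordan_lcs_1 by (simp add: numeral_2_eq_2)
next
  case False
  then have n2: "n \<ge> 2"
    using n by simp
  obtain g1 f1 g2 f2 where xy: "x = (g1, f1)" "y = (g2, f2)" by fastforce
  have x_carrier: "x \<in> riordan_carrier"
    using x riordan_lcs_subset by blast
  have "snd (rcomm x y) = nottingham_comm f1 f2"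
    using rcomm_components(1)[of g1 f1 g2 f2] x_carrier y by (simp add: xy)
  also have "\<dots> \<in> nottingham_lcs (Suc n)"
    using x y by (intro nottingham_comm_in_lcs_ge_2[OF n2]) (simp_all add: xy riordan_lcs_iff)
  finally have "snd (rcomm x y) \<in> nottingham_lcs (Suc n)" .
  moreover have "agree (2 * n) (fst (rcomm x y)) 1"
    using fst_rcomm_agree_1 x y by (simp only: xy)
  ultimately show ?thesis
    using rcomm_closed[OF x_carrier y] by (cases "rcomm x y") (simp add: riordan_lcs_iff)
qed

lemma nottingham_comm_in_lcs:
  assumes n: "n \<ge> 1" and x: "x \<in> nottingham_lcs n" and y: "y $ 0 = 0" "y $ 1 = 1"
  shows "nottingham_comm x y \<in> nottingham_lcs (Suc n)"
proof -
  have "(1, x) \<in> riordan_lcs n" "(1, y) \<in> riordan_carrier"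
    using x y by (simp_all add: riordan_lcs_iff)
  from rcomm_in_riordan_lcs[OF n this] show ?thesis
    using rcomm_Nottingham[OF nottingham_lcs_nth_0_1[OF x] y] by (simp add: riordan_lcs_iff)
qed

lemma nottingham_lcs_lead_exists:
  assumes "n \<ge> 2"
  obtains x where "x \<in> nottingham_lcs n" "even_part x $ n = 1"
proof -
  define S :: "bit fps" where "S = (if odd n then fps_X ^ (2 * n - 1)
    else fps_X ^ (2 * n - 2) + (if n = 2 then fps_X ^ 3 else 0))"
  have "of_parts (fps_X ^ n) (1 + S) \<in> nottingham_lcs n"
    using assms by (auto simp: nottingham_lcs_def near_X_def agree_def S_def)
  then show thesis
    by (rule that) simp
qed

definition nottingham_comms :: "nat \<Rightarrow> bit fps set" where
  "nottingham_comms n =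
    insert fps_X {nottingham_comm x y |x y. x \<in> nottingham_lcs n \<and> y $ 0 = 0 \<and> y $ 1 = 1}"

lemma fps_X_in_nottingham_comms: "fps_X \<in> nottingham_comms n"
  by (simp add: nottingham_comms_def)

lemma nottingham_commsI:
  "x \<in> nottingham_lcs n \<Longrightarrow> y $ 0 = 0 \<Longrightarrow> y $ 1 = 1 \<Longrightarrow> nottingham_comm x y \<in> nottingham_comms n"
  by (auto simp: nottingham_comms_def)

lemma nottingham_comms_cases:
  assumes "z \<in> nottingham_comms n"
  obtains (X) "z = fps_X"
    | (comm) x y where "z = nottingham_comm x y" "x \<in> nottingham_lcs n" "y $ 0 = 0" "y $ 1 = 1"
  using assms by (auto simp: nottingham_comms_def)

lemma nottingham_comms_subset:
  assumes "n \<ge> 1"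
  shows "nottingham_comms n \<subseteq> nottingham_lcs (Suc n)"
proof
  fix z assume "z \<in> nottingham_comms n"
  then show "z \<in> nottingham_lcs (Suc n)"
    by (cases rule: nottingham_comms_cases) (use assms nottingham_comm_in_lcs in auto)
qed

lemma near_X_nottingham_comms:
  assumes "n \<ge> 1" "z \<in> nottingham_comms n" "agree m (even_part z) 0" "agree j (odd_part z) 1"
  shows "near_X m j z"
  using assms nottingham_comms_subset[of n] nottingham_lcs_nth_0_1[of z "Suc n"]
  by (auto simp: near_X_def)

lemma nottingham_comms_even_lead:
  assumes n: "n \<ge> 1" and m: "m \<ge> n + 1"
  obtains z where "z \<in> nottingham_comms n" "near_X m (m + n - 1) z" "even_part z $ m = 1"
proof (cases "n = 1 \<or> m \<ge> n + 2")
  case True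
  define k where "k = m - 1"
  have k: "k > 0" "m = k + 1" "m + n - 1 \<le> 2 * k"
    using n m True by (auto simp: k_def)
  define z :: "bit fps" where "z = nottingham_comm (of_parts (fps_X ^ k) 1) (fps_X + fps_X ^ 3)"
  have "of_parts (fps_X ^ k) 1 \<in> nottingham_lcs n"
    using k(1,2) n True by (auto simp: nottingham_lcs_def near_X_def agree_def)
  then have z: "z \<in> nottingham_comms n"
    unfolding z_def by (rule nottingham_commsI) simp_all
  have "agree (Suc m) (even_part z) (fps_X ^ m)" "agree (2 * k) (odd_part z) 1"
    using even_part_comm_even_power[OF k(1)] odd_part_comm_even_power[OF k(1)]
    by (simp_all add: z_def k(2))
  then have "agree m (even_part z) 0" "even_part z $ m = 1" "agree (m + n - 1) (odd_part z) 1"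
    using agree_mono k(3) by (auto simp: agree_Suc_X_power)
  then show thesis
    using that z near_X_nottingham_comms[OF n z] by blast
next
  case False
  then have n2: "n \<ge> 2" and m: "m = n + 1"
    using n m by auto
  obtain x where x: "x \<in> nottingham_lcs n" "even_part x $ n = 1"
    using nottingham_lcs_lead_exists[OF n2] .
  define y z where "y = (fps_X + fps_X ^ 3 :: bit fps)" and "z = nottingham_comm x y"
  have y: "y $ 0 = 0" "y $ 1 = 1" "y $ 2 = 0" "y $ 3 = 1"
    by (simp_all add: y_def)
  have "z \<in> nottingham_comms n"
    unfolding z_def by (rule nottingham_commsI[OF x(1) y(1,2)])
  moreover have "near_X m (m + n - 1) z"
    using nottingham_lcs_near_X[OF nottingham_comm_in_lcs_ge_2[OF n2 x(1) y(1,2)]]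
    by (simp add: m mult_2 z_def)
  moreover have "even_part z $ m = 1"
    using even_part_nottingham_comm_nth[OF n2 nottingham_lcs_near_X[OF x(1)] y(1,2)] y x(2)
    by (simp add: m z_def)
  ultimately show thesis
    by (rule that)
qed

lemma nottingham_comms_first_odd_lead:
  assumes n: "n \<ge> 2" "even n"
  obtains z where "z \<in> nottingham_comms n" "agree (n + 2) (even_part z) 0"
    "agree (2 * n) (odd_part z) 1" "odd_part z $ (2 * n) = 1"
proof -
  obtain x where x: "x \<in> nottingham_lcs n" "even_part x $ n = 1"
    using nottingham_lcs_lead_exists[OF n(1)] .
  then have x_nth: "odd_part x $ (2 * n - 2) = 1" "odd_part x $ (2 * n - 1) = of_bool (n = 2)"
    using n by (auto simp: nottingham_lcs_def)
  define y z where "y = (fps_X + fps_X\<^sup>2 + (if n = 2 then fps_X ^ 3 else 0) :: bit fps)"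
    and "z = nottingham_comm x y"
  have y: "y $ 0 = 0" "y $ 1 = 1" "y $ 2 = 1" "y $ 3 = of_bool (n = 2)"
    by (simp_all add: y_def)
  note near = nottingham_lcs_near_X[OF x(1)]
  have "z \<in> nottingham_comms n"
    unfolding z_def by (rule nottingham_commsI[OF x(1) y(1,2)])
  moreover have "even_part z $ (n + 1) = 0"
    using even_part_nottingham_comm_nth[OF n(1) near y(1,2)] x(2) x_nth y n
    by (cases "n = 2") (simp_all add: z_def bit_of_nat)
  then have "agree (n + 2) (even_part z) 0"
    using even_part_nottingham_comm_agree_0[OF n(1) near y(1,2)] by (simp add: agree_Suc z_def)
  moreover have "odd_part z $ (2 * n) = 1"
    using odd_part_nottingham_comm_nth(1)[OF n(1) near y(1,2)] x(2) x_nth y n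
    by (cases "n = 2") (simp_all add: z_def bit_of_nat)
  moreover have "agree (2 * n) (odd_part z) 1"
    using odd_part_nottingham_comm_agree_1[OF near y(1,2)] by (simp add: z_def)
  ultimately show thesis
    using that by blast
qed

lemma nottingham_comms_even_index_odd_lead:
  assumes n: "n \<ge> 1" and j: "j \<ge> 2 * n + 2" "even j"
  obtains z where "z \<in> nottingham_comms n" "agree (j + 1) (even_part z) 0"
    "agree j (odd_part z) 1" "odd_part z $ j = 1"
proof -
  define r where "r = j - 1"
  have r: "odd r" "r \<ge> 3" "r \<ge> 2 * n + 1" "j = r + 1"
    using j n by (auto simp: r_def)
  define z :: "bit fps" where
    "z = nottingham_comm (of_parts (fps_X ^ r) (1 + fps_X ^ r)) (fps_X + fps_X\<^sup>2)"
  have "of_parts (fps_X ^ r) (1 + fps_X ^ r) \<in> nottingham_lcs n"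
    using r n by (auto simp: nottingham_lcs_def near_X_def agree_def)
  then have "z \<in> nottingham_comms n"
    unfolding z_def by (rule nottingham_commsI) simp_all
  moreover have "agree (j + 1) (even_part z) 0" "agree (Suc j) (odd_part z) (1 + fps_X ^ j)"
    using even_part_comm_both_powers[OF r(1,2)] odd_part_comm_both_powers[OF r(1,2)]
    by (simp_all add: z_def r(4))
  moreover have "j > 0"
    using j by simp
  ultimately show thesis
    using that by (auto simp only: agree_Suc_one_plus_X_power)
qed

lemma nottingham_comms_odd_index_odd_lead:
  assumes n: "n \<ge> 1" and j: "j \<ge> 2 * n + 3" "odd j"
  obtains z where "z \<in> nottingham_comms n" "even_part z = 0"
    "agree j (odd_part z) 1" "odd_part z $ j = 1"
proof -
  define a where "a = j - 2"
  have a: "odd a" "a \<ge> 3" "a \<ge> 2 * n + 1" "j = a + 2"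
    using j n by (auto simp: a_def)
  define z :: "bit fps" where "z = nottingham_comm (of_parts 0 (1 + fps_X ^ a)) (fps_X + fps_X ^ 3)"
  have "of_parts 0 (1 + fps_X ^ a) \<in> nottingham_lcs n"
    using a n by (auto simp: nottingham_lcs_def near_X_def agree_def)
  then have "z \<in> nottingham_comms n"
    unfolding z_def by (rule nottingham_commsI) simp_all
  moreover have "even_part z = 0" "agree (Suc j) (odd_part z) (1 + fps_X ^ j)"
    using even_part_comm_odd_power[OF a(1,2)] odd_part_comm_odd_power[OF a(1,2)]
    by (simp_all add: z_def a(4) numeral_3_eq_3)
  moreover have "j > 0"
    using j by simp
  ultimately show thesis
    using that by (auto simp only: agree_Suc_one_plus_X_power)
qed

lemma nottingham_comms_odd_lead:
  assumes n: "n \<ge> 1"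
    and j: "j = 2 * n \<and> even n \<or> j \<ge> 2 * n + 2 \<and> even j \<or> j \<ge> 2 * n + 3 \<and> odd j"
  obtains z where "z \<in> nottingham_comms n" "near_X (j + 2 - n) j z" "odd_part z $ j = 1"
proof -
  have "j + 2 - n \<le> j + 1"
    using n by simp
  consider "j = 2 * n" "n \<ge> 2" "even n" | "j \<ge> 2 * n + 2" "even j" | "j \<ge> 2 * n + 3" "odd j"
    using j n by (cases "n = 1") auto
  then obtain z where z: "z \<in> nottingham_comms n" "agree (j + 2 - n) (even_part z) 0"
    "agree j (odd_part z) 1" "odd_part z $ j = 1"
  proof cases
    case 1
    obtain z where "z \<in> nottingham_comms n" "agree (n + 2) (even_part z) 0"
      "agree (2 * n) (odd_part z) 1" "odd_part z $ (2 * n) = 1"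
      using nottingham_comms_first_odd_lead[OF 1(2,3)] .
    then show thesis
      using that 1(1) by (simp add: mult_2)
  next
    case 2
    obtain z where "z \<in> nottingham_comms n" "agree (j + 1) (even_part z) 0"
      "agree j (odd_part z) 1" "odd_part z $ j = 1"
      using nottingham_comms_even_index_odd_lead[OF n 2] .
    then show thesis
      using that agree_mono \<open>j + 2 - n \<le> j + 1\<close> by blast
  next
    case 3
    obtain z where "z \<in> nottingham_comms n" "even_part z = 0" "agree j (odd_part z) 1"
      "odd_part z $ j = 1"
      using nottingham_comms_odd_index_odd_lead[OF n 3] .
    then show thesis
      using that by simp
  qed
  then show thesis
    using that near_X_nottingham_comms[OF n z(1)] by blast
qed

lemma clear_even_lead:
  assumes n: "n \<ge> 1" and m: "m \<ge> n + 1" and j: "j \<le> m + n - 1" and f: "near_X m j f"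
  obtains z where "z \<in> nottingham_comms n" "near_X (Suc m) j (f oo z)"
proof (cases "even_part f $ m = 0")
  case True
  then show thesis
    using that[OF fps_X_in_nottingham_comms] f by (simp add: near_X_Suc_even)
next
  case False
  obtain z where z: "z \<in> nottingham_comms n" "near_X m (m + n - 1) z" "even_part z $ m = 1"
    using nottingham_comms_even_lead[OF n m] .
  have "near_X m j z"
    using z(2) j by (auto intro: near_X_mono)
  then show thesis
    using that[OF z(1)] near_X_compose_closed[OF f] even_part_compose_lead[OF f] z(3) False
    by (simp add: near_X_Suc_even)
qed

lemma clear_odd_lead:
  assumes n: "n \<ge> 1" and m: "n + 2 \<le> m" "m \<le> j + 2 - n" and j: "j \<ge> 2 * n"
    and f: "near_X m j f" "f \<in> nottingham_lcs (Suc n)"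
  obtains z where "z \<in> nottingham_comms n" "near_X m (Suc j) (f oo z)"
proof (cases "odd_part f $ j = 0")
  case True
  then show thesis
    using that[OF fps_X_in_nottingham_comms] f n j by (simp add: near_X_Suc_odd)
next
  case False
  have "even_part f $ Suc n = 0"
    using f(1) m by (simp add: near_X_def agree_def)
  then have "odd_part f $ (2 * n + 1) = 0" "odd n \<longrightarrow> odd_part f $ (2 * n) = 0"
    using f(2) n by (auto simp: nottingham_lcs_def split: if_splits)
  then have "j \<noteq> 2 * n + 1" "odd n \<longrightarrow> j \<noteq> 2 * n"
    using False by auto
  then have "j = 2 * n \<and> even n \<or> j \<ge> 2 * n + 2 \<and> even j \<or> j \<ge> 2 * n + 3 \<and> odd j"
    using j by presburger
  then obtain z where z: "z \<in> nottingham_comms n" "near_X (j + 2 - n) j z" "odd_part z $ j = 1"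
    using nottingham_comms_odd_lead[OF n] by blast
  have "near_X m j z"
    using z(2) m by (auto intro: near_X_mono)
  then show thesis
    using that[OF z(1)] near_X_compose_closed[OF f(1)] odd_part_compose_lead[OF f(1)] z(3) False n j
    by (simp add: near_X_Suc_odd)
qed

lemma nottingham_lcs_compose_closed:
  assumes "n \<ge> 1" "f \<in> nottingham_lcs n" "h \<in> nottingham_lcs n"
  shows "f oo h \<in> nottingham_lcs n"
  using subgroup.m_closed[OF subgroup_riordan_lcs[OF assms(1)], of "(1, h)" "(1, f)"] assms
  by (simp add: riordan_lcs_iff)

lemma clear_leads:
  assumes n: "n \<ge> 1" and f: "f \<in> nottingham_lcs (Suc n)" "near_X (n + 1 + i) (2 * n + i) f"
  obtains z w where "z \<in> nottingham_comms n" "w \<in> nottingham_comms n"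
    "(f oo z) oo w \<in> nottingham_lcs (Suc n)"
    "near_X (n + 1 + Suc i) (2 * n + Suc i) ((f oo z) oo w)"
proof -
  have compose: "u oo z \<in> nottingham_lcs (Suc n)"
    if "u \<in> nottingham_lcs (Suc n)" "z \<in> nottingham_comms n" for u z
    using that nottingham_comms_subset[OF n] by (auto intro: nottingham_lcs_compose_closed)
  obtain z where z: "z \<in> nottingham_comms n" "near_X (Suc (n + 1 + i)) (2 * n + i) (f oo z)"
    using clear_even_lead[OF n _ _ f(2)] by auto
  obtain w where w: "w \<in> nottingham_comms n"
    "near_X (Suc (n + 1 + i)) (Suc (2 * n + i)) ((f oo z) oo w)"
    using clear_odd_lead[OF n _ _ _ z(2) compose[OF f(1) z(1)]] by auto
  show thesis
    using that[OF z(1) w(1)] compose[OF compose[OF f(1) z(1)] w(1)] w(2) by simp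
qed

lemma nottingham_comms_in_subgroup:
  assumes K: "subgroup K Riordan"
    and comm: "\<And>x y. x \<in> riordan_lcs n \<inter> Nottingham \<Longrightarrow> y \<in> Nottingham \<Longrightarrow> rcomm x y \<in> K"
    and z: "z \<in> nottingham_comms n"
  shows "(1, z) \<in> K"
  using z
proof (cases rule: nottingham_comms_cases)
  case X
  then show ?thesis
    using subgroup.one_closed[OF K] by simp
next
  case (comm x y)
  note x = nottingham_lcs_nth_0_1[OF comm(2)]
  have "rcomm (1, x) (1, y) \<in> K"
    using comm x by (intro assms(2)) (simp_all add: riordan_lcs_iff Nottingham_iff)
  then show ?thesis
    by (simp only: rcomm_Nottingham[OF x comm(3,4)] comm(1))
qed

lemma riordan_lcs_Nottingham_subset_closed_subgroup:
  assumes n: "n \<ge> 1" and K: "subgroup K Riordan" "rclosure K = K"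
    and comm: "\<And>x y. x \<in> riordan_lcs n \<inter> Nottingham \<Longrightarrow> y \<in> Nottingham \<Longrightarrow> rcomm x y \<in> K"
  shows "riordan_lcs (Suc n) \<inter> Nottingham \<subseteq> K"
proof -
  define D :: "nat \<Rightarrow> rpair set"
    where "D i = {(1, f) |f. f \<in> nottingham_lcs (Suc n) \<and> near_X (n + 1 + i) (2 * n + i) f}" for i
  have "D 0 \<subseteq> K"
  proof (rule filtration_subset_closed_subgroup[OF K])
    show "D 0 \<subseteq> riordan_carrier"
      by (auto simp: D_def near_X_def)
    show "agree i g 1 \<and> agree i f fps_X" if "(g, f) \<in> D i" for i g f
      using that near_X_agree_X[of "n + 1 + i" "2 * n + i" f i] by (auto simp: D_def)
  next
    fix i d assume "d \<in> D i"
    then obtain f where d: "d = (1, f)"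
      and f: "f \<in> nottingham_lcs (Suc n)" "near_X (n + 1 + i) (2 * n + i) f"
      by (auto simp: D_def)
    obtain z w where zw: "z \<in> nottingham_comms n" "w \<in> nottingham_comms n"
      and fzw: "(f oo z) oo w \<in> nottingham_lcs (Suc n)"
        "near_X (n + 1 + Suc i) (2 * n + Suc i) ((f oo z) oo w)"
      using clear_leads[OF n f] .
    have "(1, w) \<otimes>\<^bsub>Riordan\<^esub> (1, z) \<in> K"
      using zw nottingham_comms_in_subgroup[OF K(1) comm] by (intro subgroup.m_closed[OF K(1)])
    moreover have "z $ 0 = 0" "w $ 0 = 0"
      using nottingham_lcs_nth_0_1(1) nottingham_comms_subset[OF n] zw by blast+
    then have "(1, w) \<otimes>\<^bsub>Riordan\<^esub> (1, z) \<otimes>\<^bsub>Riordan\<^esub> d \<in> D (Suc i)"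
      using fzw by (simp add: d D_def fps_compose_assoc)
    ultimately show "\<exists>k\<in>K. k \<otimes>\<^bsub>Riordan\<^esub> d \<in> D (Suc i)"
      by blast
  qed
  moreover have "riordan_lcs (Suc n) \<inter> Nottingham \<subseteq> D 0"
    using nottingham_lcs_near_X[of _ "Suc n"] by (auto simp: D_def riordan_lcs_iff Nottingham_iff)
  ultimately show ?thesis
    by blast
qed

lemma rcomm_Appell_lead:
  assumes n: "n \<ge> 1" and m: "m \<ge> 2 * n"
  obtains x y c where "x \<in> riordan_lcs n" "y \<in> riordan_carrier"
    "rcomm x y = (c, fps_X)" "agree (Suc m) c (1 + fps_X ^ m)"
proof -
  define k where "k = (if even m then 1 else 2 :: nat)"
  define j where "j = m - k"
  have j: "odd j" "j \<ge> 2 * n - 1" "m = j + k" "k > 0"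
    using m n by (auto simp: j_def k_def split: if_splits) presburger+
  define S y where "S = (1 + fps_X ^ j :: bit fps)" and "y = (fps_X + fps_X ^ Suc k :: bit fps)"
  have S0: "S $ 0 = 1" and y: "y $ 0 = 0" "y $ 1 = 1"
    using odd_pos[OF j(1)] by (simp_all add: S_def y_def k_def)
  have x_lcs: "(S, fps_X) \<in> riordan_lcs n"
    using j S0 by (auto simp: riordan_lcs_iff S_def agree_def)
  have carrier: "(S, fps_X) \<in> riordan_carrier" "(1, y) \<in> riordan_carrier"
    using S0 y by simp_all
  define c where "c = fst (rcomm (S, fps_X) (1, y))"
  have "agree (Suc m) (S oo y) (S + fps_X ^ m)"
    unfolding S_def y_def j(3) by (rule one_plus_X_power_compose_X_plus_X_power[OF j(1,4)])
  moreover have "(S oo y) * (c oo y) = S"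
    using rcomm_components(2)[OF carrier] y by (simp add: c_def)
  ultimately have "agree (Suc m) (c oo y) (1 + fps_X ^ m)"
    using m n by (intro agree_quotient_one_plus_X_power[where S = S and S' = "S oo y"] S0) simp_all
  then have "agree (Suc m) c (1 + fps_X ^ m)"
    using agree_compose_X_power_cancel[of m c y 1] y by simp
  moreover have "nottingham_comm fps_X y = fps_X"
    using y by (simp add: nottingham_comm_def fps_inv_right)
  then have "rcomm (S, fps_X) (1, y) = (c, fps_X)"
    using rcomm_components(1)[OF carrier] by (simp add: c_def prod_eq_iff)
  ultimately show thesis
    using that[OF x_lcs carrier(2)] by blast
qed

lemma Appell_clear_lead:
  assumes n: "n \<ge> 1" and m: "m \<ge> 2 * n" and K: "subgroup K Riordan"
    and comm: "\<And>x y. x \<in> riordan_lcs n \<Longrightarrow> y \<in> riordan_carrier \<Longrightarrow> rcomm x y \<in> K"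
    and g: "g $ 0 = 1" "agree m g 1"
  obtains c where "(c, fps_X) \<in> K" "c $ 0 = 1" "agree (Suc m) (c * g) 1"
proof (cases "g $ m = 0")
  case True
  then have "agree (Suc m) (1 * g) 1"
    using g m n by (simp add: agree_Suc)
  then show thesis
    using that[of 1] subgroup.one_closed[OF K] by simp
next
  case False
  obtain x y c where xy: "x \<in> riordan_lcs n" "y \<in> riordan_carrier" "rcomm x y = (c, fps_X)"
    and c: "agree (Suc m) c (1 + fps_X ^ m)"
    using rcomm_Appell_lead[OF n m] .
  have c_lead: "c $ 0 = 1" "agree m c 1" "c $ m = 1"
    using c agreeD[OF c, of 0] m n by (simp_all add: agree_Suc_one_plus_X_power)
  have "agree (Suc m) (c * g) (c + g + 1)"
    using agree_mult_near_1[OF c_lead(2) g(2)] by (rule agree_mono) (use m n in simp)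
  also have "agree (Suc m) (c + g + 1) 1"
    using c_lead g False m n by (auto simp: agree_Suc) (auto simp: agree_def)
  finally show thesis
    using that comm[OF xy(1,2)] xy(3) c_lead(1) by simp
qed

lemma Appell_m_subset_closed_subgroup:
  assumes n: "n \<ge> 1" and K: "subgroup K Riordan" "rclosure K = K"
    and comm: "\<And>x y. x \<in> riordan_lcs n \<Longrightarrow> y \<in> riordan_carrier \<Longrightarrow> rcomm x y \<in> K"
  shows "Appell_m (2 * n - 1) \<subseteq> K"
proof -
  define D where "D i = Appell_m (2 * n - 1 + i)" for i
  have D_iff: "d \<in> D i \<longleftrightarrow> (\<exists>g. d = (g, fps_X) \<and> g $ 0 = 1 \<and> agree (2 * n + i) g 1)" for d i
    using n by (cases d) (auto simp: D_def Appell_m_iff)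
  have "D 0 \<subseteq> K"
  proof (rule filtration_subset_closed_subgroup[OF K])
    show "D 0 \<subseteq> riordan_carrier"
      by (auto simp: D_iff)
    show "agree i g 1 \<and> agree i f fps_X" if "(g, f) \<in> D i" for i g f
      using that by (auto simp: D_iff intro: agree_mono)
  next
    fix i d assume "d \<in> D i"
    then obtain g where d: "d = (g, fps_X)" and g: "g $ 0 = 1" "agree (2 * n + i) g 1"
      by (auto simp: D_iff)
    obtain c where c: "(c, fps_X) \<in> K" "c $ 0 = 1" "agree (Suc (2 * n + i)) (c * g) 1"
      using Appell_clear_lead[OF n le_add1 K(1) comm g] .
    then have "(c, fps_X) \<otimes>\<^bsub>Riordan\<^esub> d \<in> D (Suc i)"
      using g(1) by (simp add: d D_iff)
    with c(1) show "\<exists>k\<in>K. k \<otimes>\<^bsub>Riordan\<^esub> d \<in> D (Suc i)"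
      by blast
  qed
  then show ?thesis
    by (simp add: D_def)
qed

lemma closed_comm_riordan_lcs:
  assumes n: "n \<ge> 1"
  shows "closed_comm (riordan_lcs n) riordan_carrier = riordan_lcs (Suc n)"
proof (rule closed_comm_eqI)
  show "subgroup (riordan_lcs (Suc n)) Riordan"
    by (simp add: subgroup_riordan_lcs)
  show "rclosure (riordan_lcs (Suc n)) = riordan_lcs (Suc n)"
    by (rule rclosure_riordan_lcs)
  show "rcomm x y \<in> riordan_lcs (Suc n)" if "x \<in> riordan_lcs n" "y \<in> riordan_carrier" for x y
    using n that by (rule rcomm_in_riordan_lcs)
next
  fix K assume K: "subgroup K Riordan" "rclosure K = K"
    and comm: "\<And>x y. x \<in> riordan_lcs n \<Longrightarrow> y \<in> riordan_carrier \<Longrightarrow> rcomm x y \<in> K"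
  show "riordan_lcs (Suc n) \<subseteq> K"
  proof
    fix x assume x: "x \<in> riordan_lcs (Suc n)"
    obtain g f where gf: "x = (g, f)" by fastforce
    have "(g, fps_X) \<in> Appell_m (2 * n - 1)"
      using x n by (simp add: gf riordan_lcs_iff Appell_m_iff)
    then have "(g, fps_X) \<in> K"
      using Appell_m_subset_closed_subgroup[OF n K comm] by blast
    moreover have "(1, f) \<in> riordan_lcs (Suc n) \<inter> Nottingham"
      using x nottingham_lcs_nth_0_1[of f "Suc n"] by (simp add: gf riordan_lcs_iff Nottingham_iff)
    then have "(1, f) \<in> K"
      using riordan_lcs_Nottingham_subset_closed_subgroup[OF n K] comm Nottingham_subset by blast
    ultimately show "x \<in> K"
      using subgroup.m_closed[OF K(1), of "(g, fps_X)" "(1, f)"] by (simp add: gf)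
  qed
qed

lemma closed_comm_Nottingham:
  assumes n: "n \<ge> 1"
  shows "closed_comm (riordan_lcs n \<inter> Nottingham) Nottingham = riordan_lcs (Suc n) \<inter> Nottingham"
proof (rule closed_comm_eqI)
  show "subgroup (riordan_lcs (Suc n) \<inter> Nottingham) Riordan"
    by (intro Riordan.subgroups_Inter_pair subgroup_riordan_lcs subgroup_Nottingham) simp
  show "rclosure (riordan_lcs (Suc n) \<inter> Nottingham) = riordan_lcs (Suc n) \<inter> Nottingham"
    by (intro rclosure_Int rclosure_riordan_lcs rclosure_Nottingham)
  show "rcomm x y \<in> riordan_lcs (Suc n) \<inter> Nottingham"
    if "x \<in> riordan_lcs n \<inter> Nottingham" "y \<in> Nottingham" for x y
  proof
    show "rcomm x y \<in> riordan_lcs (Suc n)"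
      using that Nottingham_subset by (intro rcomm_in_riordan_lcs[OF n]) auto
    show "rcomm x y \<in> Nottingham"
      using that unfolding rcomm_def
      by (intro subgroup.m_closed[OF subgroup_Nottingham]
          subgroup.m_inv_closed[OF subgroup_Nottingham]) auto
  qed
qed (rule riordan_lcs_Nottingham_subset_closed_subgroup[OF n])

lemma gamma_riordan_carrier:
  assumes "n \<ge> 1"
  shows "gamma riordan_carrier n = riordan_lcs n"
proof -
  have "lcs_aux riordan_carrier k = riordan_lcs (Suc k)" for k
    by (induction k) (simp_all add: closed_comm_riordan_lcs riordan_lcs_1[unfolded One_nat_def])
  then show ?thesis
    using assms by (simp add: gamma_def)
qed

lemma gamma_Nottingham:
  assumes "n \<ge> 1"
  shows "gamma Nottingham n = riordan_lcs n \<inter> Nottingham"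
proof -
  have "Nottingham = riordan_lcs 1 \<inter> Nottingham"
    unfolding riordan_lcs_1 using Nottingham_subset by blast
  then have "lcs_aux Nottingham k = riordan_lcs (Suc k) \<inter> Nottingham" for k
    by (induction k) (simp_all add: closed_comm_Nottingham)
  then show ?thesis
    using assms by (simp add: gamma_def)
qed

lemma Appell_m_lcs_index_iff:
  assumes "n \<ge> 2"
  shows "(g, f) \<in> Appell_m (2 * n - 3) \<longleftrightarrow> f = fps_X \<and> g $ 0 = 1 \<and> agree (2 * n - 2) g 1"
proof -
  have "Suc (2 * n - 3) = 2 * n - 2"
    using assms by simp
  then show ?thesis
    by (simp add: Appell_m_iff)
qed

lemma
  assumes n: "n \<ge> 2"
  shows gamma_riordan_carrier_eq_set_mult:
      "gamma riordan_carrier n = Appell_m (2 * n - 3) <#>\<^bsub>Riordan\<^esub> gamma Nottingham n"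
    and Appell_m_normal_gamma:
      "Appell_m (2 * n - 3) \<lhd> (Riordan\<lparr>carrier := gamma riordan_carrier n\<rparr>)"
    and Appell_m_Int_gamma_Nottingham: "Appell_m (2 * n - 3) \<inter> gamma Nottingham n = {\<one>\<^bsub>Riordan\<^esub>}"
proof -
  have gamma: "gamma riordan_carrier n = riordan_lcs n"
    "gamma Nottingham n = riordan_lcs n \<inter> Nottingham"
    using n by (simp_all add: gamma_riordan_carrier gamma_Nottingham)
  note Appell = Appell_m_lcs_index_iff[OF n]
  show "gamma riordan_carrier n = Appell_m (2 * n - 3) <#>\<^bsub>Riordan\<^esub> gamma Nottingham n"
    unfolding gamma
  proof (intro equalityI subsetI)
    fix x assume x: "x \<in> riordan_lcs n"
    obtain u f where uf: "x = (u, f)" by fastforce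
    have "(u, fps_X) \<in> Appell_m (2 * n - 3)" "(1, f) \<in> riordan_lcs n \<inter> Nottingham"
      using x nottingham_lcs_nth_0_1[of f n]
      by (auto simp: uf riordan_lcs_iff Appell Nottingham_iff)
    moreover have "x = (u, fps_X) \<otimes>\<^bsub>Riordan\<^esub> (1, f)"
      by (simp add: uf)
    ultimately show "x \<in> Appell_m (2 * n - 3) <#>\<^bsub>Riordan\<^esub> (riordan_lcs n \<inter> Nottingham)"
      unfolding set_mult_def by blast
  next
    fix x assume "x \<in> Appell_m (2 * n - 3) <#>\<^bsub>Riordan\<^esub> (riordan_lcs n \<inter> Nottingham)"
    then show "x \<in> riordan_lcs n"
      by (auto simp: set_mult_def riordan_lcs_iff Appell Nottingham_iff)
  qed
  have "Appell_m (2 * n - 3) \<subseteq> riordan_lcs n"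
    by (auto simp: riordan_lcs_iff Appell)
  then show "Appell_m (2 * n - 3) \<lhd> (Riordan\<lparr>carrier := gamma riordan_carrier n\<rparr>)"
    unfolding gamma using n
    by (intro Riordan.normal_restrict_supergroup subgroup_riordan_lcs Appell_m_normal) auto
  show "Appell_m (2 * n - 3) \<inter> gamma Nottingham n = {\<one>\<^bsub>Riordan\<^esub>}"
    unfolding gamma by (auto simp: riordan_lcs_iff Appell Nottingham_iff)
qed

section \<open>The abelianization\<close>

lemma Rab_eq: "Rab = Riordan Mod kernel Riordan Z2_cubed_Z4 ab_map"
  by (simp add: Rab_def gamma_riordan_carrier kernel_ab_map)

lemma F_R_eq: "F_R x = kernel Riordan Z2_cubed_Z4 ab_map #>\<^bsub>Riordan\<^esub> x"
  by (simp add: F_R_def gamma_riordan_carrier kernel_ab_map)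

definition ab_iso :: "rpair set \<Rightarrow> int \<times> int \<times> int \<times> int" where
  "ab_iso A = the_elem (ab_map ` A)"

lemma ab_iso_F_R: "x \<in> riordan_carrier \<Longrightarrow> ab_iso (F_R x) = ab_map x"
  using group_hom.the_elem_image_kernel_rcoset[OF group_hom_ab_map]
  by (simp add: ab_iso_def F_R_eq)

lemma ab_iso: "ab_iso \<in> iso Rab Z2_cubed_Z4"
  using group_hom.FactGroup_iso_set[OF group_hom_ab_map] ab_map_surj
  by (simp add: ab_iso_def[abs_def] Rab_eq)

lemma group_Rab: "group Rab"
  unfolding Rab_eq by (intro normal.factorgroup_is_group group_hom.normal_kernel group_hom_ab_map)

lemma F_R_closed: "x \<in> riordan_carrier \<Longrightarrow> F_R x \<in> carrier Rab"
  by (auto simp: Rab_eq F_R_eq FactGroup_def RCOSETS_def)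

lemma comm_group_Rab: "comm_group Rab"
proof -
  interpret H: comm_group Z2_cubed_Z4
    by (intro comm_group_DirProd comm_group_Zmod)
  have "Rab \<cong> Z2_cubed_Z4"
    using ab_iso by (rule is_isoI)
  then have "Z2_cubed_Z4 \<cong> Rab"
    by (rule group.iso_sym[OF group_Rab])
  then show ?thesis
    using group_Rab by (intro H.iso_imp_comm_group) (auto simp: group_def)
qed

lemma Z2_cubed_Z4_pow:
  "(p, q, r, s) [^]\<^bsub>Z2_cubed_Z4\<^esub> (n::nat) =
    (int n * p mod 2, int n * q mod 2, int n * r mod 2, int n * s mod 4)"
  by (induction n) (simp_all add: nat_pow_def distrib_right mod_add_right_eq mod_add_left_eq
    add.commute)

lemma ord_Rab_eqI:
  assumes u: "u \<in> carrier Rab" "ab_iso u = (p, q, r, s)"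
    and d: "\<And>n :: nat. 2 dvd int n * p \<and> 2 dvd int n * q \<and> 2 dvd int n * r \<and> 4 dvd int n * s \<longleftrightarrow>
      d dvd n"
  shows "group.ord Rab u = d"
proof -
  interpret H: group Z2_cubed_Z4
    by (intro DirProd_group group_Zmod)
  have "ab_iso u [^]\<^bsub>Z2_cubed_Z4\<^esub> n = \<one>\<^bsub>Z2_cubed_Z4\<^esub> \<longleftrightarrow> d dvd n" for n :: nat
    unfolding u(2) Z2_cubed_Z4_pow d[symmetric] by (simp add: dvd_eq_mod_eq_0)
  moreover have "ab_iso u \<in> carrier Z2_cubed_Z4"
    using ab_iso u(1) by (auto simp: iso_def hom_def)
  ultimately have "H.ord (ab_iso u) = d"
    by (simp add: H.ord_unique)
  then show ?thesis
    using iso_ord_eq[OF ab_iso group_Rab H.is_group u(1)] by simp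
qed

lemma Z2_cubed_Z4_coordinates_bij:
  "bij_betw (\<lambda>(i, j, k, l). (int i, int k, int l, (int j + 2 * int k + 2 * int l) mod 4))
     ({..<2} \<times> {..<4} \<times> {..<2} \<times> {..<2}) (carrier Z2_cubed_Z4)"
proof (rule bij_betw_byWitness
    [where f' = "\<lambda>(p, q, r, s). (nat p, nat ((s - 2 * q - 2 * r) mod 4), nat q, nat r)"])
  have "((int j + 2 * int k + 2 * int l) mod 4 - 2 * int k - 2 * int l) mod 4 = int j"
    if "j < 4" for j k l
    using that by presburger
  then show "\<forall>t\<in>{..<2} \<times> {..<4} \<times> {..<2} \<times> {..<2}.
      (case case t of (i, j, k, l) \<Rightarrow> (int i, int k, int l, (int j + 2 * int k + 2 * int l) mod 4) of
        (p, q, r, s) \<Rightarrow> (nat p, nat ((s - 2 * q - 2 * r) mod 4), nat q, nat r)) = t"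
    by auto
  have "((s - 2 * q - 2 * r) mod 4 + 2 * q + 2 * r) mod 4 = s" if "0 \<le> s" "s < 4" for q r s :: int
    using that by presburger
  then show "\<forall>v\<in>carrier Z2_cubed_Z4.
      (case case v of (p, q, r, s) \<Rightarrow> (nat p, nat ((s - 2 * q - 2 * r) mod 4), nat q, nat r) of
        (i, j, k, l) \<Rightarrow> (int i, int k, int l, (int j + 2 * int k + 2 * int l) mod 4)) = v"
    by (auto simp: carrier_Zmod)
qed (auto simp: carrier_Zmod nat_less_iff)

lemma
  defines "a \<equiv> F_R (1 + fps_X, fps_X)"
    and "b \<equiv> (\<lambda>i::nat. F_R (1, fps_X + fps_X ^ (i + 1)))"
  defines "c \<equiv> b 1 \<otimes>\<^bsub>Rab\<^esub> b 2"
  shows ord_Rab_generators: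
      "group.ord Rab a = 2 \<and> group.ord Rab (b 1) = 4 \<and> group.ord Rab c = 2 \<and> group.ord Rab (b 4) = 2"
    and Rab_words_bij: "bij_betw (\<lambda>(i, j, k, l). a [^]\<^bsub>Rab\<^esub> i \<otimes>\<^bsub>Rab\<^esub> b 1 [^]\<^bsub>Rab\<^esub> j
                             \<otimes>\<^bsub>Rab\<^esub> c [^]\<^bsub>Rab\<^esub> k \<otimes>\<^bsub>Rab\<^esub> b 4 [^]\<^bsub>Rab\<^esub> l)
               ({..<2::nat} \<times> {..<4::nat} \<times> {..<2::nat} \<times> {..<2::nat}) (carrier Rab)"
proof -
  interpret H: group Z2_cubed_Z4
    by (intro DirProd_group group_Zmod)
  interpret ab: group_hom Rab Z2_cubed_Z4 ab_iso
    using ab_iso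
    by (intro group_hom.intro group_hom_axioms.intro group_Rab H.is_group) (simp add: iso_def)
  have ab_bij: "bij_betw ab_iso (carrier Rab) (carrier Z2_cubed_Z4)"
    using ab_iso by (simp add: iso_def)
  have a_closed: "a \<in> carrier Rab"
    by (auto simp: a_def intro!: F_R_closed)
  have b_closed: "b i \<in> carrier Rab" if "i > 0" for i
    using that by (auto simp: b_def intro!: F_R_closed)
  have c_closed: "c \<in> carrier Rab"
    by (simp add: c_def b_closed)
  have ab_a: "ab_iso a = (1, 0, 0, 0)" and ab_b: "ab_iso (b 1) = (0, 0, 0, 1)"
    "ab_iso (b 2) = (0, 1, 0, 1)" "ab_iso (b 4) = (0, 0, 1, 2)"
    by (simp_all add: a_def b_def ab_iso_F_R ab_map_def even_part_nth odd_part_nth)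
  have ab_c: "ab_iso c = (0, 1, 0, 2)"
    using b_closed ab_b by (simp add: c_def)
  show "group.ord Rab a = 2 \<and> group.ord Rab (b 1) = 4 \<and>
    group.ord Rab c = 2 \<and> group.ord Rab (b 4) = 2"
    by (intro conjI ord_Rab_eqI[OF a_closed ab_a] ord_Rab_eqI[OF b_closed ab_b(1)]
        ord_Rab_eqI[OF c_closed ab_c] ord_Rab_eqI[OF b_closed ab_b(3)]) presburger+
  let ?word = "\<lambda>(i, j, k, l). a [^]\<^bsub>Rab\<^esub> i \<otimes>\<^bsub>Rab\<^esub> b 1 [^]\<^bsub>Rab\<^esub> j
    \<otimes>\<^bsub>Rab\<^esub> c [^]\<^bsub>Rab\<^esub> k \<otimes>\<^bsub>Rab\<^esub> b 4 [^]\<^bsub>Rab\<^esub> l"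
  let ?box = "{..<2::nat} \<times> {..<4::nat} \<times> {..<2::nat} \<times> {..<2::nat}"
  have word_closed: "?word ` ?box \<subseteq> carrier Rab"
    using a_closed b_closed c_closed by auto
  have "ab_iso \<circ> ?word = (\<lambda>(i, j, k, l).
      (int i mod 2, int k mod 2, int l mod 2, (int j + 2 * int k + 2 * int l) mod 4))"
    using a_closed b_closed c_closed
    by (auto simp: fun_eq_iff ab.hom_nat_pow ab_a ab_b ab_c Z2_cubed_Z4_pow mod_simps mult.commute
      simp del: One_nat_def)
  then have "bij_betw (ab_iso \<circ> ?word) ?box (carrier Z2_cubed_Z4)"
    using Z2_cubed_Z4_coordinates_bij by (auto elim!: bij_betw_cong[THEN iffD1, rotated])
  then show "bij_betw ?word ?box (carrier Rab)"
    using bij_betw_comp_iff2[OF ab_bij word_closed] by blast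
qed

theorem theorem7:
  shows "(\<forall>n::nat. n \<ge> 2 \<longrightarrow>
            gamma riordan_carrier n = Appell_m (2*n - 3) <#>\<^bsub>Riordan\<^esub> gamma Nottingham n
          \<and> Appell_m (2*n - 3) \<lhd> (Riordan\<lparr>carrier := gamma riordan_carrier n\<rparr>)
          \<and> Appell_m (2*n - 3) \<inter> gamma Nottingham n = {\<one>\<^bsub>Riordan\<^esub>})
    \<and> (Riordan\<lparr>carrier := gamma riordan_carrier 1\<rparr>) Mod gamma riordan_carrier 2
         \<cong> Zmod 2 \<times>\<times> Zmod 2 \<times>\<times> Zmod 2 \<times>\<times> Zmod 4
    \<and> (\<forall>i::nat. i \<ge> 2 \<and> even i \<longrightarrow>
         (Riordan\<lparr>carrier := gamma riordan_carrier i\<rparr>) Mod gamma riordan_carrier (i + 1)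
           \<cong> Zmod 2 \<times>\<times> Zmod 2 \<times>\<times> Zmod 2 \<times>\<times> Zmod 2)
    \<and> (\<forall>i::nat. i > 1 \<and> odd i \<longrightarrow>
         (Riordan\<lparr>carrier := gamma riordan_carrier i\<rparr>) Mod gamma riordan_carrier (i + 1)
           \<cong> Zmod 2 \<times>\<times> Zmod 2 \<times>\<times> Zmod 2 \<times>\<times> Zmod 2 \<times>\<times> Zmod 2 \<times>\<times> Zmod 2)
    \<and> (let a = F_R (1 + fps_X, fps_X);
           b = (\<lambda>i::nat. F_R (1, fps_X + fps_X ^ (i + 1)));
           c = b 1 \<otimes>\<^bsub>Rab\<^esub> b 2
       in comm_group Rab
          \<and> group.ord Rab a = 2 \<and> group.ord Rab (b 1) = 4
          \<and> group.ord Rab c = 2 \<and> group.ord Rab (b 4) = 2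
          \<and> bij_betw (\<lambda>(i, j, k, l). a [^]\<^bsub>Rab\<^esub> i \<otimes>\<^bsub>Rab\<^esub> b 1 [^]\<^bsub>Rab\<^esub> j
                                   \<otimes>\<^bsub>Rab\<^esub> c [^]\<^bsub>Rab\<^esub> k \<otimes>\<^bsub>Rab\<^esub> b 4 [^]\<^bsub>Rab\<^esub> l)
               ({..<2::nat} \<times> {..<4::nat} \<times> {..<2::nat} \<times> {..<2::nat}) (carrier Rab))"
proof -
  note gamma = gamma_riordan_carrier
  have "Riordan\<lparr>carrier := gamma riordan_carrier 1\<rparr> = Riordan"
    using gamma[of 1] unfolding riordan_lcs_1 by (simp add: Riordan_def)
  then have quotient_1:
    "(Riordan\<lparr>carrier := gamma riordan_carrier 1\<rparr>) Mod gamma riordan_carrier 2 \<cong> Z2_cubed_Z4"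
    using riordan_lcs_quotient_1 by (simp add: gamma)
  have quotient_even:
    "(Riordan\<lparr>carrier := gamma riordan_carrier i\<rparr>) Mod gamma riordan_carrier (i + 1) \<cong> Z2_pow_4"
    if "i \<ge> 2 \<and> even i" for i
    using riordan_lcs_quotient_even[of i] that by (simp add: gamma)
  have quotient_odd:
    "(Riordan\<lparr>carrier := gamma riordan_carrier i\<rparr>) Mod gamma riordan_carrier (i + 1) \<cong> Z2_pow_6"
    if "i > 1 \<and> odd i" for i
    using riordan_lcs_quotient_odd[of i] that by (simp add: gamma)
  show ?thesis
    using gamma_riordan_carrier_eq_set_mult Appell_m_normal_gamma Appell_m_Int_gamma_Nottingham
      quotient_1 quotient_even quotient_odd comm_group_Rab ord_Rab_generators Rab_words_bij
    unfolding Let_def by (intro conjI allI impI; blast)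
qed

end
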